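(* Let $A,B,E$ be classes and $f:E\to A$, $g:E\to B$ functions (a class span). Consider the following data. <br>- An object is a set-valued matrix $X$ from $A$ to $B$, i.e. a family of sets $(X(a,b))_{a\in A,b\in B}$. <br>- A loose-loose morphism $X_0,\ldots,X_{n-1}\to Y$ consists of a function $$X_0(fi_0,gi_1)\times\cdots\times X_{n-1}(fi_{n-1},gi_n)\to Y(fi_0,gi_n)$$ for all $i_0,\ldots,i_n\in E$. <br>- A tight-loose morphism $\lfloor W,X_0,\ldots,X_{n-1}\to Y$ consists of a function $$W(a,gi_0)\times X_0(fi_0,gi_1)\times\cdots\times X_{n-1}(fi_{n-1},gi_n)\to Y(a,gi_n)$$ for all $a\in A$ and $i_0,\ldots,i_n\in E$. <br>- A loose-tight morphism $X_0,\ldots,X_{n-1},V\rfloor\to Y$ consists of a function $$X_0(fi_0,gi_1)\times\cdots\times X_{n-1}(fi_{n-1},gi_n)\times V(fi_n,b)\to Y(fi_0,b)$$ for all $i_0,\ldots,i_n\in E$ and $b\in B$. <br>- A tight-tight morphism $\lfloor W,X_0,\ldots,X_{n-1},V\rfloor\to Y$ consists of a function $$W(a,gi_0)\times X_0(fi_0,gi_1)\times\cdots\times X_{n-1}(fi_{n-1},gi_n)\times V(fi_n,b)\to Y(a,b)$$ for all $a\in A$, $i_0,\ldots,i_n\in E$ and $b\in B$. <br>- A tight-tight morphism $\lfloor W\rfloor\to Y$ consists of a function $W(a,b)\to Y(a,b)$ for all $a\in A$ and $b\in B$. <br>- Left-loosening, right-loosening, composition and identities are the evident ones (written out in the context). <br>These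 form a (hyperlarge) bi-skew multicategory, and a category on the class span is precisely a monoid in it. That is, monoids $(\mathcal{C},m,e)$ in this bi-skew multicategory correspond bijectively to categories on the class span with the same underlying family of sets $\mathcal{C}$, where the composition functions $\mathcal{C}(a,gi)\times\mathcal{C}(fi,b)\to\mathcal{C}(a,b)$ are the components of $m$ and the identities $\mathrm{id}_i\in\mathcal{C}(fi,gi)$ are the components of $e$.
   Context: **Conventions.** Composition is written in diagrammatic order. One distinguishes sets, classes and collections; notions such as bi-skew multicategory are defined with a class of objects and sets of morphisms, and the "hyperlarge" version is obtained by replacing "class" and "set" by "collection". **Category on a class span.** For a class span $f:E\to A$, $g:E\to B$, a category on it consists of a family of sets $(\mathcal{C}(a,b))_{a\in A,b\in B}$, a composition function $;_{a,i,b}:\mathcal{C}(a,gi)\times\mathcal{C}(fi,b)\to\mathcal{C}(a,b)$ for all $a\in A,i\in E,b\in B$, and an element $\mathrm{id}_i\in\mathcal{C}(fi,gi)$ for all $i\in E$, such that: $\mathrm{id}_i;l=l$ for $l\in\mathcal{C}(fi,b)$; $h;\mathrm{id}_i=h$ for $h\in\mathcal{C}(a,gi)$; and $(h;k);l=h;(k;l)$ for $h\in\mathcal{C}(a,gi)$, $k\in\mathcal{C}(fi,gj)$, $l\in\mathcal{C}(fj,b)$. **Bi-skew multicategory.** Consists of a class of objects; for every (possibly empty) object list $\vec a$ and object $x$ a set of loose-loose morphisms $\vec a\to x$; for every nonempty list $\vec a$ and object $x$ sets of tight-loose morphisms $\lfloor\vec a\to x$, loose-tight morphisms $\vec a\rfloor\to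 x$ and tight-tight morphisms $\lfloor\vec a\rfloor\to x$; a left-loosening operation $f\mapsto\acute f$ from tight-loose to loose-loose and from tight-tight to loose-tight morphisms; a right-loosening operation $f\mapsto\grave f$ from loose-tight to loose-loose and from tight-tight to tight-loose morphisms; for each object $x$ a tight-tight identity $\mathrm{id}_x:\lfloor x\rfloor\to x$; and compositions $g\circ_x f$ (at a specified occurrence of $x$) of the following forms: - (A) $g:\vec a,x,\vec c\to y$ and $f:\vec b\to x$, giving $\vec a,\vec b,\vec c\to y$; - (B) $g:\lfloor\vec a,x,\vec c\to y$ with $\vec a$ nonempty and $f:\vec b\to x$, giving $\lfloor\vec a,\vec b,\vec c\to y$; - (C) $g:\vec a,x,\vec c\rfloor\to y$ with $\vec c$ nonempty and $f:\vec b\to x$, giving $\vec a,\vec b,\vec c\rfloor\to y$; - (D) $g:\lfloor\vec a,x,\vec c\rfloor\to y$ with $\vec a,\vec c$ nonempty and $f:\vec b\to x$, giving $\lfloor\vec a,\vec b,\vec c\rfloor\to y$; - (E) $g:\lfloor x,\vec b\to y$ and $f:\lfloor\vec a\to x$, giving $\lfloor\vec a,\vec b\to y$; - (F) $g:\lfloor x,\vec b\rfloor\to y$ with $\vec b$ nonempty and $f:\lfloor\vec a\to x$, giving $\lfloor\vec a,\vec b\rfloor\to y$; - (G) $g:\vec a,x\rfloor\to y$ and $f:\vec b\rfloor\to x$, giving $\vec a,\vec b\rfloor\to y$; - (H) $g:\lfloor\vec a,x\rfloor\to y$ with $\vec a$ nonempty and $f:\vec b\rfloor\to x$, giving $\lfloor\vec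 a,\vec b\rfloor\to y$; - (I) $g:\lfloor x\rfloor\to y$ and $f:\lfloor\vec a\rfloor\to x$, giving $\lfloor\vec a\rfloor\to y$. Axioms: left- and right-loosening commute (write $\hat f$ for the result of applying both to a tight-tight $f$); left-loosening commutes with each composition form whose $g$ is left-tight, and right-loosening with each form whose $g$ is right-tight (the loosening of the composite is the composite of the loosened $g$ with $f$, where $f$ is loosened on the same side if it is tight on that side); composing an identity (loosened as needed) into any input of $g$ gives $g$; composing any $f$ into an identity (loosened as needed) gives $f$; associativity $h\circ_y(g\circ_x f)=(h\circ_y g)\circ_x f$ for all well-typed combinations of forms; interchange: composing two morphisms into two distinct inputs of $h$ gives the same result in either order, for all well-typed combinations. **Monoid in a bi-skew multicategory.** An object $x$ with a tight-tight $m:\lfloor x,x\rfloor\to x$ and a nullary loose-loose $e:\ \to x$ such that: composing $e$ into the first input of $\acute m$ gives $\acute{\mathrm{id}}_x$; composing $e$ into the second input of $\grave m$ gives $\grave{\mathrm{id}}_x$; composing $\grave m$ into the first input of $m$ (form F) equals composing $\acute m$ into the second input of $m$ (form H). **Structure of the bi-skew multicategory in the claim.** Left-loosening restricts the family to those $a$ of the form $f(i)$, $i\in E$ (the component at $i,i_0,\ldots$ is the given component at $a=f(i)$); right-loosening similarly restricts to $b=g(i)$, $i\in E$. Identities are identity functions $W(a,b)\to W(a,b)$. Every composition form is given by substituting the value of the inner morphism as the relevant argument of the outer one, at matching indices. *)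

theory Defs
  imports "HOL-Library.FuncSet"
begin

section \<open>Bi-skew multicategories\<close>

text \<open>
  The four kinds of morphism are indexed by two flags \<open>l\<close> and \<open>r\<close>, where \<open>True\<close> means tight and
  \<open>False\<close> means loose: \<open>Hom M l r xs y\<close> is the collection of morphisms \<open>xs \<rightarrow> y\<close> that are tight
  on the left iff \<open>l\<close> and tight on the right iff \<open>r\<close>. The operations carry all the indices of
  the hom-collections they act on, so these need not be disjoint.
  No size condition is imposed, i.e. this is the hyperlarge version of the notion.

  \<open>cmp M l r us x ws vs y g f\<close> is the composite \<open>g \<circ>\<^sub>x f\<close> at the displayed occurrence of \<open>x\<close>, for
  \<open>g : us, x, ws \<rightarrow> y\<close> with flags \<open>l\<close>, \<open>r\<close> and \<open>f : vs \<rightarrow> x\<close>. The inner morphism \<open>f\<close> has to be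
  tight on a side exactly if \<open>g\<close> is tight on this side and \<open>x\<close> is the outermost input there, i.e.
  the flags of \<open>f\<close> are \<open>l \<and> us = []\<close> and \<open>r \<and> ws = []\<close>; the composite has the flags of \<open>g\<close>.
  This yields nine forms:

  \<^item> \<open>g\<close> loose-loose: \<open>f\<close> is loose-loose;
  \<^item> \<open>g\<close> tight-loose: \<open>f\<close> is loose-loose if \<open>us \<noteq> []\<close>, tight-loose if \<open>us = []\<close>;
  \<^item> \<open>g\<close> loose-tight: \<open>f\<close> is loose-loose if \<open>ws \<noteq> []\<close>, loose-tight if \<open>ws = []\<close>;
  \<^item> \<open>g\<close> tight-tight: \<open>f\<close> is loose-loose if \<open>us \<noteq> []\<close>, \<open>ws \<noteq> []\<close>, tight-loose if
    \<open>us = []\<close>, \<open>ws \<noteq> []\<close>, loose-tight if \<open>us \<noteq> []\<close>, \<open>ws = []\<close>, and tight-tight if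
    \<open>us = []\<close>, \<open>ws = []\<close>.
\<close>

record ('o, 'm) bsm =
  Obj :: "'o set"
  Hom :: "bool \<Rightarrow> bool \<Rightarrow> 'o list \<Rightarrow> 'o \<Rightarrow> 'm set"
  lloosen :: "bool \<Rightarrow> 'o list \<Rightarrow> 'o \<Rightarrow> 'm \<Rightarrow> 'm"
  rloosen :: "bool \<Rightarrow> 'o list \<Rightarrow> 'o \<Rightarrow> 'm \<Rightarrow> 'm"
  ident :: "'o \<Rightarrow> 'm"
  cmp :: "bool \<Rightarrow> bool \<Rightarrow> 'o list \<Rightarrow> 'o \<Rightarrow> 'o list \<Rightarrow> 'o list \<Rightarrow> 'o \<Rightarrow> 'm \<Rightarrow> 'm \<Rightarrow> 'm"

text \<open>Only loose-loose morphisms may have an empty domain.\<close>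

definition mor :: "('o, 'm) bsm \<Rightarrow> bool \<Rightarrow> bool \<Rightarrow> 'o list \<Rightarrow> 'o \<Rightarrow> 'm \<Rightarrow> bool" where
  "mor M l r xs y h \<longleftrightarrow>
     set xs \<subseteq> Obj M \<and> y \<in> Obj M \<and> (l \<or> r \<longrightarrow> xs \<noteq> []) \<and> h \<in> Hom M l r xs y"

text \<open>The identity, loosened on the sides whose flag is \<open>False\<close>.\<close>

definition loosened_ident :: "('o, 'm) bsm \<Rightarrow> bool \<Rightarrow> bool \<Rightarrow> 'o \<Rightarrow> 'm" where
  "loosened_ident M l r x =
     (let h = (if r then ident M x else rloosen M True [x] x (ident M x))
      in if l then h else lloosen M r [x] x h)"

text \<open>
  The first flag of \<open>lloosen\<close> is the right flag of its argument; the first flag of \<open>rloosen\<close> is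
  the left flag of its argument.
\<close>

locale bi_skew_multicategory =
  fixes M :: "('o, 'm) bsm"
  assumes lloosen_mor:
      "mor M True r xs y h \<Longrightarrow> mor M False r xs y (lloosen M r xs y h)"
    and rloosen_mor:
      "mor M l True xs y h \<Longrightarrow> mor M l False xs y (rloosen M l xs y h)"
    and ident_mor:
      "x \<in> Obj M \<Longrightarrow> mor M True True [x] x (ident M x)"
    and cmp_mor:
      "mor M l r (us @ x # ws) y g \<Longrightarrow> mor M (l \<and> us = []) (r \<and> ws = []) vs x h \<Longrightarrow>
       mor M l r (us @ vs @ ws) y (cmp M l r us x ws vs y g h)"
    and loosen_commute:
      "mor M True True xs y h \<Longrightarrow>
       lloosen M False xs y (rloosen M True xs y h) = rloosen M False xs y (lloosen M True xs y h)"
    and lloosen_cmp: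
      "mor M True r (us @ x # ws) y g \<Longrightarrow> mor M (us = []) (r \<and> ws = []) vs x h \<Longrightarrow>
       lloosen M r (us @ vs @ ws) y (cmp M True r us x ws vs y g h) =
       cmp M False r us x ws vs y (lloosen M r (us @ x # ws) y g)
         (if us = [] then lloosen M (r \<and> ws = []) vs x h else h)"
    and rloosen_cmp:
      "mor M l True (us @ x # ws) y g \<Longrightarrow> mor M (l \<and> us = []) (ws = []) vs x h \<Longrightarrow>
       rloosen M l (us @ vs @ ws) y (cmp M l True us x ws vs y g h) =
       cmp M l False us x ws vs y (rloosen M l (us @ x # ws) y g)
         (if ws = [] then rloosen M (l \<and> us = []) vs x h else h)"
    and cmp_ident:
      "mor M l r (us @ x # ws) y g \<Longrightarrow>
       cmp M l r us x ws [x] y g (loosened_ident M (l \<and> us = []) (r \<and> ws = []) x) = g"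
    and ident_cmp:
      "mor M l r vs x h \<Longrightarrow> cmp M l r [] x [] vs x (loosened_ident M l r x) h = h"
    and cmp_assoc:
      "mor M l r (us @ y # zs) z k \<Longrightarrow>
       mor M (l \<and> us = []) (r \<and> zs = []) (vs @ x # ws) y g \<Longrightarrow>
       mor M (l \<and> us = [] \<and> vs = []) (r \<and> zs = [] \<and> ws = []) ts x h \<Longrightarrow>
       cmp M l r us y zs (vs @ ts @ ws) z k
         (cmp M (l \<and> us = []) (r \<and> zs = []) vs x ws ts y g h) =
       cmp M l r (us @ vs) x (ws @ zs) ts z (cmp M l r us y zs (vs @ x # ws) z k g) h"
    and cmp_interchange:
      "mor M l r (us @ x # vs @ y # ws) z k \<Longrightarrow>
       mor M (l \<and> us = []) False ss x g \<Longrightarrow>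
       mor M False (r \<and> ws = []) ts y h \<Longrightarrow>
       cmp M l r (us @ ss @ vs) y ws ts z (cmp M l r us x (vs @ y # ws) ss z k g) h =
       cmp M l r us x (vs @ ts @ ws) ss z (cmp M l r (us @ x # vs) y ws ts z k h) g"

definition bsm_monoid :: "('o, 'm) bsm \<Rightarrow> 'o \<Rightarrow> 'm \<Rightarrow> 'm \<Rightarrow> bool" where
  "bsm_monoid M x m e \<longleftrightarrow>
     mor M True True [x, x] x m \<and> mor M False False [] x e \<and>
     cmp M False True [] x [x] [] x (lloosen M True [x, x] x m) e =
       lloosen M True [x] x (ident M x) \<and>
     cmp M True False [x] x [] [] x (rloosen M True [x, x] x m) e =
       rloosen M True [x] x (ident M x) \<and>
     cmp M True True [] x [x] [x, x] x m (rloosen M True [x, x] x m) =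
       cmp M True True [x] x [] [x, x] x m (lloosen M True [x, x] x m)"


section \<open>Categories on a span\<close>

text \<open>
  The classes are sets \<open>A\<close>, \<open>B\<close>, \<open>E\<close> over arbitrary types, and the sets \<open>X(a, b)\<close> have their
  elements in an arbitrary type. Families are extensional functions, so that equality is equality
  of families.
\<close>

definition matrices :: "'a set \<Rightarrow> 'b set \<Rightarrow> ('a \<times> 'b \<Rightarrow> 'x set) set" where
  "matrices A B = extensional (A \<times> B)"

definition category_on_span ::
  "'a set \<Rightarrow> 'b set \<Rightarrow> 'e set \<Rightarrow> ('e \<Rightarrow> 'a) \<Rightarrow> ('e \<Rightarrow> 'b) \<Rightarrow> ('a \<times> 'b \<Rightarrow> 'x set) \<Rightarrow>
   ('a \<times> 'e \<times> 'b \<Rightarrow> 'x \<times> 'x \<Rightarrow> 'x) \<Rightarrow> ('e \<Rightarrow> 'x) \<Rightarrow> bool" where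
  "category_on_span A B E f g C c u \<longleftrightarrow>
     C \<in> matrices A B \<and>
     c \<in> (\<Pi>\<^sub>E (a, i, b) \<in> A \<times> E \<times> B. C (a, g i) \<times> C (f i, b) \<rightarrow>\<^sub>E C (a, b)) \<and>
     u \<in> (\<Pi>\<^sub>E i \<in> E. C (f i, g i)) \<and>
     (\<forall>i\<in>E. \<forall>b\<in>B. \<forall>l\<in>C (f i, b). c (f i, i, b) (u i, l) = l) \<and>
     (\<forall>a\<in>A. \<forall>i\<in>E. \<forall>h\<in>C (a, g i). c (a, i, g i) (h, u i) = h) \<and>
     (\<forall>a\<in>A. \<forall>i\<in>E. \<forall>j\<in>E. \<forall>b\<in>B. \<forall>h\<in>C (a, g i). \<forall>k\<in>C (f i, g j). \<forall>l\<in>C (f j, b).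
        c (a, j, b) (c (a, i, g j) (h, k), l) = c (a, i, b) (h, c (f i, j, b) (k, l)))"


section \<open>The bi-skew multicategory of matrices on a span\<close>

text \<open>
  The components of all four kinds of morphism are indexed by triples \<open>(s, js, t)\<close>, where \<open>js\<close> is
  the list of the indices in \<open>E\<close>, \<open>s\<close> is \<open>Some a\<close> for left-tight and \<open>None\<close> for left-loose
  morphisms, and \<open>t\<close> is \<open>Some b\<close> for right-tight and \<open>None\<close> for right-loose morphisms. Each
  component is a function on argument lists. The row indices of the factors are \<open>a\<close> (if present)
  followed by the \<open>f i\<close>, the column indices are the \<open>g i\<close> followed by \<open>b\<close> (if present). For a
  left-loose morphism the first \<open>g i\<close> is the column of no factor, and for a right-loose
  morphism the last \<open>f i\<close> is the row of no factor. The target has the first row and the last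
  column index. The lemmas below spell this out for each kind of morphism.
\<close>

type_synonym ('a, 'b, 'e) index = "'a option \<times> 'e list \<times> 'b option"

type_synonym ('a, 'b, 'e, 'x) matmor = "('a, 'b, 'e) index \<times> 'x list \<Rightarrow> 'x"

fun rows :: "('e \<Rightarrow> 'a) \<Rightarrow> ('a, 'b, 'e) index \<Rightarrow> 'a list" where
  "rows f (s, js, t) = (case s of None \<Rightarrow> [] | Some a \<Rightarrow> [a]) @ map f js"

fun cols :: "('e \<Rightarrow> 'b) \<Rightarrow> ('a, 'b, 'e) index \<Rightarrow> 'b list" where
  "cols g (s, js, t) = map g js @ (case t of None \<Rightarrow> [] | Some b \<Rightarrow> [b])"

definition indices ::
  "'a set \<Rightarrow> 'b set \<Rightarrow> 'e set \<Rightarrow> bool \<Rightarrow> bool \<Rightarrow> nat \<Rightarrow> ('a, 'b, 'e) index set" where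
  "indices A B E l r n =
     {(s, js, t). s \<in> (if l then Some ` A else {None}) \<and> js \<in> lists E \<and>
        t \<in> (if r then Some ` B else {None}) \<and>
        length js + of_bool l + of_bool r = n + 1}"

definition arguments ::
  "('e \<Rightarrow> 'a) \<Rightarrow> ('e \<Rightarrow> 'b) \<Rightarrow> bool \<Rightarrow> ('a \<times> 'b \<Rightarrow> 'x set) list \<Rightarrow> ('a, 'b, 'e) index \<Rightarrow>
   'x list set" where
  "arguments f g l Xs p =
     {zs. length zs = length Xs \<and>
        (\<forall>k < length Xs. zs ! k \<in> (Xs ! k) (rows f p ! k, cols g p ! (if l then k else k + 1)))}"

definition dom_mor ::
  "'a set \<Rightarrow> 'b set \<Rightarrow> 'e set \<Rightarrow> ('e \<Rightarrow> 'a) \<Rightarrow> ('e \<Rightarrow> 'b) \<Rightarrow> bool \<Rightarrow> bool \<Rightarrow>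
   ('a \<times> 'b \<Rightarrow> 'x set) list \<Rightarrow> (('a, 'b, 'e) index \<times> 'x list) set" where
  "dom_mor A B E f g l r Xs =
     (SIGMA p : indices A B E l r (length Xs). arguments f g l Xs p)"

definition mat_hom ::
  "'a set \<Rightarrow> 'b set \<Rightarrow> 'e set \<Rightarrow> ('e \<Rightarrow> 'a) \<Rightarrow> ('e \<Rightarrow> 'b) \<Rightarrow> bool \<Rightarrow> bool \<Rightarrow>
   ('a \<times> 'b \<Rightarrow> 'x set) list \<Rightarrow> ('a \<times> 'b \<Rightarrow> 'x set) \<Rightarrow> ('a, 'b, 'e, 'x) matmor set" where
  "mat_hom A B E f g l r Xs Y =
     (\<Pi>\<^sub>E (p, zs) \<in> dom_mor A B E f g l r Xs. Y (hd (rows f p), last (cols g p)))"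

text \<open>The product \<open>X\<^sub>0(f i\<^sub>0, g i\<^sub>1) \<times> \<dots> \<times> X\<^sub>n\<^sub>-\<^sub>1(f i\<^sub>n\<^sub>-\<^sub>1, g i\<^sub>n)\<close> for \<open>js = [i\<^sub>0, \<dots>, i\<^sub>n]\<close>:\<close>

definition chain ::
  "('e \<Rightarrow> 'a) \<Rightarrow> ('e \<Rightarrow> 'b) \<Rightarrow> ('a \<times> 'b \<Rightarrow> 'x set) list \<Rightarrow> 'e list \<Rightarrow> 'x list set" where
  "chain f g Xs js =
     {zs. length zs = length Xs \<and> (\<forall>k < length Xs. zs ! k \<in> (Xs ! k) (f (js ! k), g (js ! Suc k)))}"

lemma mat_hom_iff:
  "\<phi> \<in> mat_hom A B E f g l r Xs Y \<longleftrightarrow>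
   \<phi> \<in> extensional (dom_mor A B E f g l r Xs) \<and>
   (\<forall>p \<in> indices A B E l r (length Xs). \<forall>zs \<in> arguments f g l Xs p.
      \<phi> (p, zs) \<in> Y (hd (rows f p), last (cols g p)))"
  unfolding mat_hom_def PiE_iff dom_mor_def by auto

lemma ball_indices:
  "(\<forall>p \<in> indices A B E False False n. P p) \<longleftrightarrow>
     (\<forall>js \<in> lists E. length js = n + 1 \<longrightarrow> P (None, js, None))"
  "(\<forall>p \<in> indices A B E True False n. P p) \<longleftrightarrow>
     (\<forall>a \<in> A. \<forall>js \<in> lists E. length js = n \<longrightarrow> P (Some a, js, None))"
  "(\<forall>p \<in> indices A B E False True n. P p) \<longleftrightarrow>
     (\<forall>js \<in> lists E. \<forall>b \<in> B. length js = n \<longrightarrow> P (None, js, Some b))"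
  "(\<forall>p \<in> indices A B E True True n. P p) \<longleftrightarrow>
     (\<forall>a \<in> A. \<forall>js \<in> lists E. \<forall>b \<in> B. length js + 1 = n \<longrightarrow> P (Some a, js, Some b))"
  unfolding indices_def by auto

lemma arguments_loose_loose:
  assumes "length js = length Xs + 1"
  shows "arguments f g False Xs (None, js, None) = chain f g Xs js"
  using assms by (auto simp: arguments_def chain_def)

lemma arguments_tight_loose:
  assumes "length js = length Xs + 1"
  shows "arguments f g True (W # Xs) (Some a, js, None) =
    {w # zs | w zs. w \<in> W (a, g (hd js)) \<and> zs \<in> chain f g Xs js}" (is "?L = ?R")
proof (intro set_eqI)
  fix ys
  have "js \<noteq> []" using assms by auto
  then show "ys \<in> ?L \<longleftrightarrow> ys \<in> ?R" using assms
    by (cases ys) (auto simp: arguments_def chain_def All_less_Suc2 hd_conv_nth)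
qed

lemma arguments_loose_tight:
  assumes "length js = length Xs + 1"
  shows "arguments f g False (Xs @ [V]) (None, js, Some b) =
    {zs @ [v] | zs v. zs \<in> chain f g Xs js \<and> v \<in> V (f (last js), b)}" (is "?L = ?R")
proof (intro set_eqI)
  fix ys
  have "js \<noteq> []" using assms by auto
  then show "ys \<in> ?L \<longleftrightarrow> ys \<in> ?R" using assms
    by (cases ys rule: rev_cases)
      (auto simp: arguments_def chain_def All_less_Suc nth_append last_conv_nth)
qed

lemma arguments_tight_tight:
  assumes "length js = length Xs + 1"
  shows "arguments f g True (W # Xs @ [V]) (Some a, js, Some b) =
    {w # zs @ [v] | w zs v.
       w \<in> W (a, g (hd js)) \<and> zs \<in> chain f g Xs js \<and> v \<in> V (f (last js), b)}"
proof -
  have "arguments f g True (W # Xs @ [V]) (Some a, js, Some b) =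
    {w # zs | w zs. w \<in> W (a, g (hd js)) \<and> zs \<in> arguments f g False (Xs @ [V]) (None, js, Some b)}"
    (is "?L = ?R")
  proof (intro set_eqI)
    fix ys
    have "js \<noteq> []" using assms by auto
    then show "ys \<in> ?L \<longleftrightarrow> ys \<in> ?R" using assms
      by (cases ys) (auto simp: arguments_def All_less_Suc2 hd_conv_nth nth_append)
  qed
  then show ?thesis
    unfolding arguments_loose_tight[OF assms] by blast
qed

lemma mat_hom_loose_loose:
  "\<phi> \<in> mat_hom A B E f g False False Xs Y \<longleftrightarrow>
   \<phi> \<in> extensional (dom_mor A B E f g False False Xs) \<and>
   (\<forall>js \<in> lists E. length js = length Xs + 1 \<longrightarrow> (\<forall>zs \<in> chain f g Xs js.
      \<phi> ((None, js, None), zs) \<in> Y (f (hd js), g (last js))))"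
proof -
  have "hd (map f js) = f (hd js)" "last (map g js) = g (last js)"
    if "length js = Suc (length Xs)" for js
    using that by (cases js; simp add: hd_map last_map)+
  then show ?thesis
    unfolding mat_hom_iff ball_indices
    by (simp add: arguments_loose_loose cong: conj_cong imp_cong)
qed

lemma mat_hom_tight_loose:
  "\<phi> \<in> mat_hom A B E f g True False (W # Xs) Y \<longleftrightarrow>
   \<phi> \<in> extensional (dom_mor A B E f g True False (W # Xs)) \<and>
   (\<forall>a \<in> A. \<forall>js \<in> lists E. length js = length Xs + 1 \<longrightarrow>
      (\<forall>w \<in> W (a, g (hd js)). \<forall>zs \<in> chain f g Xs js.
         \<phi> ((Some a, js, None), w # zs) \<in> Y (a, g (last js))))"
proof -
  have "last (map g js) = g (last js)"
    if "length js = Suc (length Xs)" for js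
    using that by (cases js; simp add: hd_map last_map)+
  then show ?thesis
    unfolding mat_hom_iff ball_indices
    by (simp add: arguments_tight_loose cong: conj_cong imp_cong) blast
qed

lemma mat_hom_loose_tight:
  "\<phi> \<in> mat_hom A B E f g False True (Xs @ [V]) Y \<longleftrightarrow>
   \<phi> \<in> extensional (dom_mor A B E f g False True (Xs @ [V])) \<and>
   (\<forall>js \<in> lists E. \<forall>b \<in> B. length js = length Xs + 1 \<longrightarrow>
      (\<forall>zs \<in> chain f g Xs js. \<forall>v \<in> V (f (last js), b).
         \<phi> ((None, js, Some b), zs @ [v]) \<in> Y (f (hd js), b)))"
proof -
  have "hd (map f js) = f (hd js)"
    if "length js = Suc (length Xs)" for js
    using that by (cases js; simp add: hd_map last_map)+
  then show ?thesis
    unfolding mat_hom_iff ball_indices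
    by (simp add: arguments_loose_tight cong: conj_cong imp_cong) blast
qed

lemma mat_hom_tight_tight:
  "\<phi> \<in> mat_hom A B E f g True True (W # Xs @ [V]) Y \<longleftrightarrow>
   \<phi> \<in> extensional (dom_mor A B E f g True True (W # Xs @ [V])) \<and>
   (\<forall>a \<in> A. \<forall>js \<in> lists E. \<forall>b \<in> B. length js = length Xs + 1 \<longrightarrow>
      (\<forall>w \<in> W (a, g (hd js)). \<forall>zs \<in> chain f g Xs js. \<forall>v \<in> V (f (last js), b).
         \<phi> ((Some a, js, Some b), w # zs @ [v]) \<in> Y (a, b)))"
  unfolding mat_hom_iff ball_indices
  by (simp add: arguments_tight_tight cong: conj_cong imp_cong) blast

lemma mat_hom_tight_tight_single:
  "\<phi> \<in> mat_hom A B E f g True True [W] Y \<longleftrightarrow>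
   \<phi> \<in> extensional (dom_mor A B E f g True True [W]) \<and>
   (\<forall>a \<in> A. \<forall>b \<in> B. \<forall>w \<in> W (a, b). \<phi> ((Some a, [], Some b), [w]) \<in> Y (a, b))"
proof -
  have "arguments f g True [W] (Some a, [], Some b) = {[w] | w. w \<in> W (a, b)}" for a b
    by (auto simp: arguments_def length_Suc_conv)
  then show ?thesis
    unfolding mat_hom_iff ball_indices by auto
qed

definition mat_lloosen ::
  "'a set \<Rightarrow> 'b set \<Rightarrow> 'e set \<Rightarrow> ('e \<Rightarrow> 'a) \<Rightarrow> ('e \<Rightarrow> 'b) \<Rightarrow> bool \<Rightarrow>
   ('a \<times> 'b \<Rightarrow> 'x set) list \<Rightarrow> ('a, 'b, 'e, 'x) matmor \<Rightarrow> ('a, 'b, 'e, 'x) matmor" where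
  "mat_lloosen A B E f g r Xs \<phi> =
     (\<lambda>((s, js, t), zs) \<in> dom_mor A B E f g False r Xs. \<phi> ((Some (f (hd js)), tl js, t), zs))"

definition mat_rloosen ::
  "'a set \<Rightarrow> 'b set \<Rightarrow> 'e set \<Rightarrow> ('e \<Rightarrow> 'a) \<Rightarrow> ('e \<Rightarrow> 'b) \<Rightarrow> bool \<Rightarrow>
   ('a \<times> 'b \<Rightarrow> 'x set) list \<Rightarrow> ('a, 'b, 'e, 'x) matmor \<Rightarrow> ('a, 'b, 'e, 'x) matmor" where
  "mat_rloosen A B E f g l Xs \<phi> =
     (\<lambda>((s, js, t), zs) \<in> dom_mor A B E f g l False Xs.
        \<phi> ((s, butlast js, Some (g (last js))), zs))"

definition mat_ident ::
  "'a set \<Rightarrow> 'b set \<Rightarrow> 'e set \<Rightarrow> ('e \<Rightarrow> 'a) \<Rightarrow> ('e \<Rightarrow> 'b) \<Rightarrow>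
   ('a \<times> 'b \<Rightarrow> 'x set) \<Rightarrow> ('a, 'b, 'e, 'x) matmor" where
  "mat_ident A B E f g W = (\<lambda>(p, zs) \<in> dom_mor A B E f g True True [W]. hd zs)"

text \<open>
  In a composite, the index list splits as \<open>js1 @ js2 @ js3\<close>, where \<open>js2\<close> is the index list of the
  inner morphism \<open>\<psi>\<close>. If \<open>\<psi>\<close> is left-loose, its target has row \<open>f (hd js2)\<close>, so \<open>hd js2\<close> also
  occurs in the index list of the outer morphism; similarly on the right.
\<close>

definition mat_cmp ::
  "'a set \<Rightarrow> 'b set \<Rightarrow> 'e set \<Rightarrow> ('e \<Rightarrow> 'a) \<Rightarrow> ('e \<Rightarrow> 'b) \<Rightarrow> bool \<Rightarrow> bool \<Rightarrow>
   ('a \<times> 'b \<Rightarrow> 'x set) list \<Rightarrow> ('a \<times> 'b \<Rightarrow> 'x set) list \<Rightarrow> ('a \<times> 'b \<Rightarrow> 'x set) list \<Rightarrow>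
   ('a, 'b, 'e, 'x) matmor \<Rightarrow> ('a, 'b, 'e, 'x) matmor \<Rightarrow> ('a, 'b, 'e, 'x) matmor" where
  "mat_cmp A B E f g l r Us Ws Vs \<phi> \<psi> =
     (\<lambda>((s, js, t), zs) \<in> dom_mor A B E f g l r (Us @ Vs @ Ws).
        let l' = (l \<and> Us = []); r' = (r \<and> Ws = []);
            p = length Us - of_bool l;
            q = length Vs + 1 - of_bool l' - of_bool r';
            js1 = take p js; js2 = take q (drop p js); js3 = drop (p + q) js;
            zs1 = take (length Us) zs;
            zs2 = take (length Vs) (drop (length Us) zs);
            zs3 = drop (length Us + length Vs) zs;
            z = \<psi> ((if l' then s else None, js2, if r' then t else None), zs2)
        in \<phi> ((s, js1 @ (if l' then [] else [hd js2]) @ (if r' then [] else [last js2]) @ js3, t),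
              zs1 @ z # zs3))"

definition mat_bsm ::
  "'a set \<Rightarrow> 'b set \<Rightarrow> 'e set \<Rightarrow> ('e \<Rightarrow> 'a) \<Rightarrow> ('e \<Rightarrow> 'b) \<Rightarrow>
   ('a \<times> 'b \<Rightarrow> 'x set, ('a, 'b, 'e, 'x) matmor) bsm" where
  "mat_bsm A B E f g =
     \<lparr>Obj = matrices A B,
      Hom = mat_hom A B E f g,
      lloosen = (\<lambda>r Xs Y. mat_lloosen A B E f g r Xs),
      rloosen = (\<lambda>l Xs Y. mat_rloosen A B E f g l Xs),
      ident = mat_ident A B E f g,
      cmp = (\<lambda>l r Us X Ws Vs Y. mat_cmp A B E f g l r Us Ws Vs)\<rparr>"

text \<open>
  The components of \<open>m : C, C \<rightarrow> C\<close> (tight-tight) and of \<open>e : [] \<rightarrow> C\<close> (loose-loose), as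
  families of the shape required of a category.
\<close>

definition mult_components ::
  "'a set \<Rightarrow> 'b set \<Rightarrow> 'e set \<Rightarrow> ('e \<Rightarrow> 'a) \<Rightarrow> ('e \<Rightarrow> 'b) \<Rightarrow> ('a \<times> 'b \<Rightarrow> 'x set) \<Rightarrow>
   ('a, 'b, 'e, 'x) matmor \<Rightarrow> 'a \<times> 'e \<times> 'b \<Rightarrow> 'x \<times> 'x \<Rightarrow> 'x" where
  "mult_components A B E f g C m =
     (\<lambda>(a, i, b) \<in> A \<times> E \<times> B. \<lambda>(h, k) \<in> C (a, g i) \<times> C (f i, b).
        m ((Some a, [i], Some b), [h, k]))"

definition unit_components ::
  "'e set \<Rightarrow> ('a, 'b, 'e, 'x) matmor \<Rightarrow> 'e \<Rightarrow> 'x" where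
  "unit_components E e = (\<lambda>i \<in> E. e ((None, [i], None), []))"

end

theory Submission
  imports Defs
begin

text \<open>
  An index \<open>(s, js, t)\<close> of a component of a morphism \<open>X\<^sub>0, \<dots>, X\<^sub>n\<^sub>-\<^sub>1 \<rightarrow> Y\<close> is a list of \<open>n + 1\<close>
  points, the two outermost ones lying in \<open>A\<close>, \<open>B\<close> or \<open>E\<close> according to the flags and all others
  in \<open>E\<close>; the factor \<open>X\<^sub>k\<close> sits between the points \<open>k\<close> and \<open>k + 1\<close>. In this form the composition
  no longer depends on the flags. Cutting the points of the composite into \<open>P1 @ P2 @ P3\<close>, of
  lengths \<open>|us|\<close>, \<open>|vs|\<close> and \<open>|ws| + 1\<close>, the inner morphism is taken at \<open>P2 @ [hd P3]\<close> and the
  outer one at \<open>P1 @ hd (P2 @ P3) # P3\<close>. Loosening replaces an outermost point \<open>i\<close> by \<open>f i\<close> or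
  \<open>g i\<close>. All axioms of a bi-skew multicategory thereby become identities between lists, and the
  three monoid axioms, evaluated at lists of at most four points, are those of a category.
\<close>

section \<open>Index triples as lists of points\<close>

datatype ('a, 'b, 'e) point = Row 'a | Col 'b | Mid 'e

text \<open>A factor between the points \<open>p\<close> and \<open>q\<close> lies in row
  \<open>row_of f p\<close> and column \<open>col_of g q\<close>, so a \<open>Mid\<close> point
  serves as column for the factor on its left and as row for the one on its right.\<close>

fun row_of :: "('e \<Rightarrow> 'a) \<Rightarrow> ('a, 'b, 'e) point \<Rightarrow> 'a" where
  "row_of f (Row a) = a"
| "row_of f (Mid i) = f i"
| "row_of f (Col b) = undefined"

fun col_of :: "('e \<Rightarrow> 'b) \<Rightarrow> ('a, 'b, 'e) point \<Rightarrow> 'b" where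
  "col_of g (Col b) = b"
| "col_of g (Mid i) = g i"
| "col_of g (Row a) = undefined"

fun mids :: "('a, 'b, 'e) point list \<Rightarrow> 'e list" where
  "mids [] = []"
| "mids (p # P) = (case p of Mid i \<Rightarrow> [i] | _ \<Rightarrow> []) @ mids P"

lemma mids_append [simp]: "mids (P @ Q) = mids P @ mids Q"
  by (induction P) auto

lemma mids_map_Mid [simp]: "mids (map Mid js) = js"
  by (induction js) auto

definition idx :: "('a, 'b, 'e) point list \<Rightarrow> ('a, 'b, 'e) index" where
  "idx P = (case hd P of Row a \<Rightarrow> Some a | _ \<Rightarrow> None, mids P,
     case last P of Col b \<Rightarrow> Some b | _ \<Rightarrow> None)"

fun points_of :: "('a, 'b, 'e) index \<Rightarrow> ('a, 'b, 'e) point list" where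
  "points_of (s, js, t) =
     (case s of None \<Rightarrow> [] | Some a \<Rightarrow> [Row a]) @ map Mid js @
     (case t of None \<Rightarrow> [] | Some b \<Rightarrow> [Col b])"

text \<open>The excluded index has no points, so \<open>idx\<close> would take \<open>hd\<close> and
  \<open>last\<close> of the empty list. It belongs to no set \<open>indices A B E l r n\<close>,
  where there are always \<open>n + 1\<close> points.\<close>

lemma idx_points_of: "p \<noteq> (None, [], None) \<Longrightarrow> idx (points_of p) = p"
  by (cases p) (auto simp: idx_def hd_append hd_map last_map split: option.splits)

section \<open>Labelled lists of points as the domain of a family of components\<close>

locale span =
  fixes A :: "'a set" and B :: "'b set" and E :: "'e set"
    and f :: "'e \<Rightarrow> 'a" and g :: "'e \<Rightarrow> 'b"
  assumes f_in: "f \<in> E \<rightarrow> A" and g_in: "g \<in> E \<rightarrow> B"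
begin

text \<open>The flags say whether the point is a tight left end and whether it is a tight right end.
  It would be both only for a tight-tight morphism without factors, which has no index.\<close>

definition points :: "bool \<Rightarrow> bool \<Rightarrow> ('a, 'b, 'e) point set" where
  "points l r =
     (if l then if r then {} else Row ` A else if r then Col ` B else Mid ` E)"

lemma points_simps [simp]:
  "points True True = {}" "points True False = Row ` A"
  "points False True = Col ` B" "points False False = Mid ` E"
  by (simp_all add: points_def)

lemma points_iff [simp]:
  "Row a \<in> points l r \<longleftrightarrow> l \<and> \<not> r \<and> a \<in> A"
  "Col b \<in> points l r \<longleftrightarrow> \<not> l \<and> r \<and> b \<in> B"
  "Mid i \<in> points l r \<longleftrightarrow> \<not> l \<and> \<not> r \<and> i \<in> E"
  by (auto simp: points_def)

text \<open>This is \<open>dom_mor\<close> in terms of points, by recursion on the factors. Only the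
  first point can be a tight left end, hence the flag \<open>False\<close> in the recursive
  call.\<close>

fun labelling :: "bool \<Rightarrow> bool \<Rightarrow> ('a \<times> 'b \<Rightarrow> 'x set) list \<Rightarrow> ('a, 'b, 'e) point list \<Rightarrow>
    'x list \<Rightarrow> bool" where
  "labelling l r [] P zs \<longleftrightarrow> zs = [] \<and> (\<exists>p \<in> points l r. P = [p])"
| "labelling l r (X # Xs) (p # P) (z # zs) \<longleftrightarrow>
     P \<noteq> [] \<and> p \<in> points l False \<and> z \<in> X (row_of f p, col_of g (hd P)) \<and> labelling False r Xs P zs"
| "labelling l r (X # Xs) [] zs \<longleftrightarrow> False"
| "labelling l r (X # Xs) P [] \<longleftrightarrow> False"

lemma labelling_Cons:
  "labelling l r (X # Xs) P zs \<longleftrightarrow>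
     (\<exists>p P' z zs'. P = p # P' \<and> zs = z # zs' \<and> P' \<noteq> [] \<and> p \<in> points l False \<and>
        z \<in> X (row_of f p, col_of g (hd P')) \<and> labelling False r Xs P' zs')"
  by (cases P; cases zs) auto

lemma labelling_length:
  "labelling l r Xs P zs \<Longrightarrow> length P = Suc (length Xs) \<and> length zs = length Xs"
  by (induction l r Xs P zs rule: labelling.induct) auto

text \<open>A labelling is cut at a point, which then belongs to both pieces. The shared point is a
  tight end only if no factor lies between it and that end of the whole list.\<close>

lemma labelling_append:
  assumes "length P1 = length Us" "length z1 = length Us" "P2 \<noteq> []"
  shows "labelling l r (Us @ Vs) (P1 @ P2) (z1 @ z2) \<longleftrightarrow>
    labelling l (r \<and> Vs = []) Us (P1 @ [hd P2]) z1 \<and> labelling (l \<and> Us = []) r Vs P2 z2"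
  using assms
proof (induction Us arbitrary: P1 z1 l)
  case Nil
  then show ?case by (cases Vs) (auto simp: labelling_Cons)
next
  case (Cons X Us)
  obtain p P1' z z1' where "P1 = p # P1'" "z1 = z # z1'"
    using Cons.prems by (auto simp: length_Suc_conv)
  with Cons show ?case by (auto simp: hd_append)
qed

lemma All_le_Suc2: "(\<forall>k \<le> Suc n. Q k) \<longleftrightarrow> Q 0 \<and> (\<forall>k \<le> n. Q (Suc k))"
  using All_less_Suc2[of "Suc n" Q] by (simp add: less_Suc_eq_le)

text \<open>The positionwise form matches \<open>arguments\<close>, while the recursive form serves
  for cutting.\<close>

lemma labelling_nth:
  "labelling l r Xs P zs \<longleftrightarrow>
     length P = Suc (length Xs) \<and> length zs = length Xs \<and>
     (\<forall>k \<le> length Xs. P ! k \<in> points (l \<and> k = 0) (r \<and> k = length Xs)) \<and>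
     (\<forall>k < length Xs. zs ! k \<in> (Xs ! k) (row_of f (P ! k), col_of g (P ! Suc k)))"
proof (induction l r Xs P zs rule: labelling.induct)
  case (1 l r P zs)
  then show ?case by (auto simp: length_Suc_conv)
next
  case (2 l r X Xs p P z zs)
  have "P ! 0 = hd P" if "P \<noteq> []"
    using that by (simp add: hd_conv_nth)
  with 2 show ?case
    by (cases "P = []") (auto simp: All_less_Suc2 All_le_Suc2)
qed auto

lemma labelling_points_of:
  "labelling l r Xs (points_of p) zs \<longleftrightarrow> (p, zs) \<in> dom_mor A B E f g l r Xs"
proof -
  obtain s js t where p: "p = (s, js, t)" by (cases p)
  define n where "n = length Xs"
  define P where "P = points_of p"
  have indices: "length P = Suc n \<and> (\<forall>k \<le> n. P ! k \<in> points (l \<and> k = 0) (r \<and> k = n)) \<longleftrightarrow>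
    p \<in> indices A B E l r n"
  proof -
    have lists: "js \<in> lists E \<longleftrightarrow> (\<forall>k < length js. js ! k \<in> E)"
      by (simp add: in_lists_conv_set all_set_conv_all_nth)
    have le: "(\<forall>k \<le> m. Q k) \<longleftrightarrow> (\<forall>k < m. Q k) \<and> Q m" for m :: nat and Q
      by (auto simp: le_less)
    have mid: "Mid i \<in> Mid ` E \<longleftrightarrow> i \<in> E" for i :: 'e and E by auto
    show ?thesis
    \<comment> \<open>For \<open>n = 0\<close> one point carries both flags; otherwise the first and
      the last point are distinct.\<close>
    proof (cases n)
      case 0
      then show ?thesis
        unfolding P_def p indices_def
        by (cases s; cases t) (auto simp: length_Suc_conv lists)
    next
      case (Suc m)
      then show ?thesis
        unfolding P_def p indices_def
        by (cases s; cases t)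
          (auto simp: lists nth_append All_le_Suc2 All_less_Suc2 le All_less_Suc mid;
            metis less_Suc_eq less_Suc_eq_0_disj less_SucI)+
    qed
  qed
  have rows: "rows f p ! k = row_of f (P ! k)" if "length P = Suc n" "k < n" for k
    using that unfolding P_def p
    by (auto simp: nth_append nth_Cons' split: option.splits)
  \<comment> \<open>\<open>cols\<close> omits a leading \<open>Row\<close> point, so the point at
    position \<open>k + 1\<close> has position \<open>k\<close> in it if the left side is tight and
    \<open>k + 1\<close> otherwise.\<close>
  have cols: "cols g p ! (if l then k else k + 1) = col_of g (P ! Suc k)"
    if "length P = Suc n" "k < n" "l \<longleftrightarrow> s \<noteq> None" for k
    using that unfolding P_def p
    by (auto simp: nth_append nth_Cons' split: option.splits)
  have "l \<longleftrightarrow> s \<noteq> None" if "p \<in> indices A B E l r n"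
    using that by (auto simp: p indices_def split: if_splits)
  then show ?thesis
    unfolding labelling_nth dom_mor_def arguments_def
    using indices rows cols by (auto simp flip: P_def n_def)
qed

lemma labelling_points_of_idx:
  assumes "labelling l r Xs P zs"
  shows "points_of (idx P) = P" "(idx P, zs) \<in> dom_mor A B E f g l r Xs"
proof -
  \<comment> \<open>The conjunct on \<open>s\<close> carries the induction: the tail is left-loose,
    hence of the form \<open>points_of (None, js, t)\<close>, and so a further point can be put in
    front.\<close>
  from assms have "\<exists>s js t. P = points_of (s, js, t) \<and> (\<not> l \<longrightarrow> s = None)"
  proof (induction l r Xs P zs rule: labelling.induct)
    case (1 l r P zs)
    then obtain p where p: "p \<in> points l r" "P = [p]" by auto
    show ?case
    proof (cases p)
      case (Row a)
      with p show ?thesis by (intro exI[of _ "Some a"] exI[of _ "[]"] exI[of _ None]) auto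
    next
      case (Col b)
      with p show ?thesis by (intro exI[of _ None] exI[of _ "[]"] exI[of _ "Some b"]) auto
    next
      case (Mid i)
      with p show ?thesis by (intro exI[of _ None] exI[of _ "[i]"] exI[of _ None]) auto
    qed
  next
    case (2 l r X Xs p P z zs)
    then obtain js t where P: "P = points_of (None, js, t)" by auto
    show ?case
    proof (cases p)
      case (Row a)
      with 2 P show ?thesis by (intro exI[of _ "Some a"] exI[of _ js] exI[of _ t]) auto
    next
      case (Mid i)
      with P show ?thesis by (intro exI[of _ None] exI[of _ "i # js"] exI[of _ t]) auto
    qed (use 2 in auto)
  qed auto
  then obtain p where p: "P = points_of p" by blast
  moreover from p assms have dom: "(p, zs) \<in> dom_mor A B E f g l r Xs"
    by (simp only: labelling_points_of)
  then have "p \<noteq> (None, [], None)"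
    by (auto simp: dom_mor_def indices_def split: if_splits)
  ultimately show "points_of (idx P) = P" "(idx P, zs) \<in> dom_mor A B E f g l r Xs"
    using dom by (metis idx_points_of)+
qed

lemma dom_mor_iff:
  "x \<in> dom_mor A B E f g l r Xs \<longleftrightarrow> (\<exists>P zs. x = (idx P, zs) \<and> labelling l r Xs P zs)"
proof
  assume x: "x \<in> dom_mor A B E f g l r Xs"
  obtain p zs where p: "x = (p, zs)" by (cases x)
  with x have "p \<noteq> (None, [], None)"
    by (auto simp: dom_mor_def indices_def split: if_splits)
  then show "\<exists>P zs. x = (idx P, zs) \<and> labelling l r Xs P zs"
    using x p by (metis idx_points_of labelling_points_of)
qed (auto intro: labelling_points_of_idx)

text \<open>This count yields the positions at which \<open>mat_cmp\<close> cuts the index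
  list.\<close>

lemma length_mids:
  assumes "labelling l r Xs P zs"
  shows "length (mids P) + of_bool l + of_bool r = length Xs + 1"
  using labelling_points_of_idx(2)[OF assms] by (auto simp: dom_mor_def indices_def idx_def)

text \<open>With no factors and exactly one tight side, the only point would be a \<open>Row\<close>
  or a \<open>Col\<close>, which lacks the column or the row of the target.\<close>

definition nondegenerate :: "bool \<Rightarrow> bool \<Rightarrow> 'y list \<Rightarrow> bool" where
  "nondegenerate l r Xs \<longleftrightarrow> (l \<or> r \<longrightarrow> Xs \<noteq> [])"

text \<open>By nondegeneracy the two ends are distinct points or one and the same \<open>Mid\<close>
  point, so the first has a row and the last has a column.\<close>

lemma labelling_ends:
  assumes "labelling l r Xs P zs" "nondegenerate l r Xs"
  shows "P \<noteq> []" "hd P \<in> points l False" "last P \<in> points False r"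
proof -
  show ne: "P \<noteq> []" using assms by (cases Xs) auto
  then have "hd P = P ! 0" "last P = P ! length Xs"
    using labelling_length[OF assms(1)] by (auto simp: hd_conv_nth last_conv_nth)
  then show "hd P \<in> points l False" "last P \<in> points False r"
    using assms by (cases "Xs = []"; auto simp: labelling_nth nondegenerate_def)+
qed

lemma rows_idx:
  assumes "labelling l r Xs P zs" "nondegenerate l r Xs"
  shows "hd (rows f (idx P)) = row_of f (hd P)" "last (cols g (idx P)) = col_of g (last P)"
proof -
  obtain s js t where p: "idx P = (s, js, t)" by (cases "idx P")
  have P: "P = points_of (s, js, t)"
    using labelling_points_of_idx(1)[OF assms(1)] p by simp
  show "hd (rows f (idx P)) = row_of f (hd P)" "last (cols g (idx P)) = col_of g (last P)"
    unfolding p using labelling_ends[OF assms] unfolding P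
    by (auto simp: hd_append last_append hd_map last_map points_def split: option.splits if_splits)
qed

lemma mat_hom_labelling:
  assumes "nondegenerate l r Xs"
  shows "\<phi> \<in> mat_hom A B E f g l r Xs Y \<longleftrightarrow>
    \<phi> \<in> extensional (dom_mor A B E f g l r Xs) \<and>
    (\<forall>P zs. labelling l r Xs P zs \<longrightarrow>
       \<phi> (idx P, zs) \<in> Y (row_of f (hd P), col_of g (last P)))"
proof -
  have "(\<forall>x \<in> dom_mor A B E f g l r Xs. Q x) \<longleftrightarrow> (\<forall>P zs. labelling l r Xs P zs \<longrightarrow> Q (idx P, zs))"
    for Q by (auto simp: dom_mor_iff)
  then show ?thesis
    unfolding mat_hom_def PiE_iff
    by (auto simp: rows_idx[OF _ assms] simp del: rows.simps cols.simps)
qed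

text \<open>The equational axioms are equations between extensional families, so each can be checked
  at one labelling at a time.\<close>

lemma matmor_eqI:
  assumes "\<phi> \<in> extensional (dom_mor A B E f g l r Xs)"
    and "\<psi> \<in> extensional (dom_mor A B E f g l r Xs)"
    and "\<And>P zs. labelling l r Xs P zs \<Longrightarrow> \<phi> (idx P, zs) = \<psi> (idx P, zs)"
  shows "\<phi> = \<psi>"
  using assms by (intro extensionalityI[of _ "dom_mor A B E f g l r Xs"]) (auto simp: dom_mor_iff)

section \<open>Loosening in terms of points\<close>

lemma labelling_lloosen:
  assumes "labelling False r Xs (p # P) zs" "Xs \<noteq> []"
  shows "labelling True r Xs (Row (row_of f p) # P) zs"
    "mat_lloosen A B E f g r Xs \<phi> (idx (p # P), zs) = \<phi> (idx (Row (row_of f p) # P), zs)"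
proof -
  \<comment> \<open>Since there is a factor, the first point of a left-loose labelling is some
    \<open>Mid i\<close>. The factors read only its row, so \<open>Row (f i)\<close> can replace
    it.\<close>
  from assms obtain i where "i \<in> E" "p = Mid i" "P \<noteq> []"
    by (cases Xs; cases zs) auto
  then show "labelling True r Xs (Row (row_of f p) # P) zs"
    "mat_lloosen A B E f g r Xs \<phi> (idx (p # P), zs) = \<phi> (idx (Row (row_of f p) # P), zs)"
    using assms funcset_mem[OF f_in \<open>i \<in> E\<close>] labelling_points_of_idx(2)[OF assms(1)]
    by (auto simp: mat_lloosen_def idx_def labelling_Cons neq_Nil_conv)
qed

lemma labelling_rloosen:
  assumes "labelling l False Xs (P @ [q]) zs" "Xs \<noteq> []"
  shows "labelling l True Xs (P @ [Col (col_of g q)]) zs"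
    "mat_rloosen A B E f g l Xs \<phi> (idx (P @ [q]), zs) = \<phi> (idx (P @ [Col (col_of g q)]), zs)"
proof -
  have len: "length P = length Xs" "length zs = length Xs"
    using labelling_length[OF assms(1)] by auto
  then have "P \<noteq> []" using assms by auto
  obtain i where "i \<in> E" "q = Mid i"
    using labelling_ends(3)[OF assms(1)] assms(2) by (auto simp: nondegenerate_def)
  \<comment> \<open>\<open>labelling\<close> recurses from the left, so a change of the last point
    is checked position by position.\<close>
  have nth: "(P @ [c]) ! k = (if k < length Xs then P ! k else c)" if "k \<le> length Xs" for k c
    using that len by (auto simp: nth_append)
  show "labelling l True Xs (P @ [Col (col_of g q)]) zs"
    unfolding labelling_nth
  proof (intro conjI allI impI)
    fix k assume "k \<le> length Xs"
    then show "(P @ [Col (col_of g q)]) ! k \<in> points (l \<and> k = 0) (True \<and> k = length Xs)"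
      using assms \<open>i \<in> E\<close> \<open>q = Mid i\<close> funcset_mem[OF g_in \<open>i \<in> E\<close>] nth[of k]
      by (auto simp: labelling_nth)
  next
    fix k assume "k < length Xs"
    then show "zs ! k \<in> (Xs ! k) (row_of f ((P @ [Col (col_of g q)]) ! k),
        col_of g ((P @ [Col (col_of g q)]) ! Suc k))"
      using assms nth[of k] nth[of "Suc k"]
      by (auto simp: labelling_nth split: if_splits)
  qed (use len in auto)
  show "mat_rloosen A B E f g l Xs \<phi> (idx (P @ [q]), zs) = \<phi> (idx (P @ [Col (col_of g q)]), zs)"
    using labelling_points_of_idx(2)[OF assms(1)] \<open>P \<noteq> []\<close> \<open>q = Mid i\<close>
    by (auto simp: mat_rloosen_def idx_def hd_append)
qed

section \<open>Composition in terms of points\<close>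

lemma labelling_split:
  assumes "labelling l r (Us @ Vs @ Ws) P zs"
  obtains P1 P2 P3 z1 z2 z3 where "P = P1 @ P2 @ P3" "zs = z1 @ z2 @ z3"
    "length P1 = length Us" "length z1 = length Us" "length P2 = length Vs" "length z2 = length Vs"
    "length P3 = Suc (length Ws)" "length z3 = length Ws"
proof -
  let ?P = "drop (length Us) P" and ?zs = "drop (length Us) zs"
  show ?thesis
    using labelling_length[OF assms] that[of "take (length Us) P" "take (length Vs) ?P"
      "drop (length Vs) ?P" "take (length Us) zs" "take (length Vs) ?zs" "drop (length Vs) ?zs"]
    by (simp del: drop_drop)
qed

text \<open>The points of the composite are cut at \<open>hd (P2 @ P3)\<close> and at
  \<open>hd P3\<close>. The inner morphism runs from the first cut point to the second; in the outer
  one a single factor spans them. If the inner morphism is nullary, the two cut points coincide and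
  this point occurs twice in the outer list.\<close>

lemma
  assumes "labelling l r (Us @ Vs @ Ws) (P1 @ P2 @ P3) (z1 @ z2 @ z3)"
    and len: "length P1 = length Us" "length z1 = length Us" "length P2 = length Vs"
      "length z2 = length Vs"
    and nd: "nondegenerate (l \<and> Us = []) (r \<and> Ws = []) Vs"
  shows labelling_inner: "labelling (l \<and> Us = []) (r \<and> Ws = []) Vs (P2 @ [hd P3]) z2"
    and labelling_outer: "y \<in> X (row_of f (hd (P2 @ P3)), col_of g (hd P3)) \<Longrightarrow>
      labelling l r (Us @ X # Ws) (P1 @ hd (P2 @ P3) # P3) (z1 @ y # z3)"
    and mat_cmp_labelling: "mat_cmp A B E f g l r Us Ws Vs \<phi> \<psi> (idx (P1 @ P2 @ P3), z1 @ z2 @ z3) =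
      \<phi> (idx (P1 @ hd (P2 @ P3) # P3), z1 @ \<psi> (idx (P2 @ [hd P3]), z2) # z3)"
proof -
  have "length (P1 @ P2 @ P3) = Suc (length (Us @ Vs @ Ws))"
    using labelling_length[OF assms(1)] by blast
  then have "P3 \<noteq> []" using len by auto
  then obtain c P3' where P3: "P3 = c # P3'" by (cases P3) auto
  have 0: "labelling l (r \<and> Vs @ Ws = []) Us (P1 @ [hd (P2 @ P3)]) z1"
    and 2: "labelling (l \<and> Us = []) (r \<and> Ws = []) Vs (P2 @ [hd P3]) z2"
    and 3: "labelling (l \<and> Us = [] \<and> Vs = []) r Ws P3 z3"
    using assms \<open>P3 \<noteq> []\<close> by (auto simp: labelling_append)
  show "labelling (l \<and> Us = []) (r \<and> Ws = []) Vs (P2 @ [hd P3]) z2" by (fact 2)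
  \<comment> \<open>If \<open>Vs\<close> is empty, the cut points coincide, and by nondegeneracy of
    the inner morphism this point is a tight end on neither side.\<close>
  have Vs: "(r \<and> Vs @ Ws = []) = False" "(l \<and> Us = [] \<and> Vs = []) = False"
    using nd by (auto simp: nondegenerate_def)
  have 1: "labelling l False Us (P1 @ [hd (P2 @ P3)]) z1"
    using 0 unfolding Vs(1) .
  have hd_in: "hd (P2 @ P3) \<in> points (l \<and> Us = []) False"
    using labelling_ends(2)[OF 2 nd] by (cases P2) auto
  have c_in: "c \<in> points False (r \<and> Ws = [])"
    using labelling_ends(3)[OF 2 nd] by (simp add: P3)
  show "labelling l r (Us @ X # Ws) (P1 @ hd (P2 @ P3) # P3) (z1 @ y # z3)"
    if "y \<in> X (row_of f (hd (P2 @ P3)), col_of g (hd P3))"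
    using that 1 3 Vs hd_in \<open>P3 \<noteq> []\<close> len by (simp add: labelling_append)
  \<comment> \<open>This number is \<open>q\<close> in \<open>mat_cmp\<close>, and the one in
    \<open>m1\<close> is \<open>p\<close>.\<close>
  have m2: "length (mids (P2 @ [c])) = length Vs + 1 - of_bool (l \<and> Us = []) - of_bool (r \<and> Ws = [])"
    using length_mids[OF 2] by (simp add: P3)
  have m1: "length (mids P1) = length Us - of_bool l"
  \<comment> \<open>For empty \<open>Us\<close> the subtraction is truncated, which gives 0 also if
    \<open>l\<close> holds.\<close>
  proof (cases "Us = []")
    case False
    with hd_in have "length (mids [hd (P2 @ P3)]) = 1" by auto
    then show ?thesis using length_mids[OF 1] by simp
  qed (use len in auto)
  have Nil: "mids P1 = []" if "Us = []"
    using len that by simp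
  \<comment> \<open>A cut point that is not a tight end is an index in \<open>E\<close>, namely the
    last or the first one of the inner morphism. This is where \<open>mat_cmp\<close> takes
    \<open>last js2\<close> and \<open>hd js2\<close> from.\<close>
  have c: "mids [c] = (if r \<and> Ws = [] then [] else [last (mids (P2 @ [c]))])"
    using c_in by auto
  have h: "mids [hd (P2 @ P3)] = (if l \<and> Us = [] then [] else [hd (mids (P2 @ [c]))])"
    using hd_in by (cases P2) (auto simp: P3)
  \<comment> \<open>The composite and the outer morphism have the same two outermost points, so
    \<open>S\<close> and \<open>T\<close> serve for both.\<close>
  define S where "S = (case hd (P1 @ P2 @ P3) of Row a \<Rightarrow> Some a | _ \<Rightarrow> None)"
  define T where "T = (case last P3 of Col b \<Rightarrow> Some b | _ \<Rightarrow> None)"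
  have idx_comp: "idx (P1 @ P2 @ P3) = (S, mids P1 @ mids (P2 @ [c]) @ mids P3', T)"
    by (simp add: idx_def P3 S_def T_def)
  have "idx (P1 @ hd (P2 @ P3) # P3) =
      (S, mids P1 @ mids [hd (P2 @ P3)] @ mids [c] @ mids P3', T)"
    by (simp add: idx_def P3 S_def T_def hd_append)
  note idx_outer = this[unfolded c h]
  have idx_inner: "idx (P2 @ [hd P3]) =
      (if l \<and> Us = [] then S else None, mids (P2 @ [c]), if r \<and> Ws = [] then T else None)"
  proof -
    have "(case hd (P2 @ [c]) of Row a \<Rightarrow> Some a | _ \<Rightarrow> None) = (if l \<and> Us = [] then S else None)"
      using hd_in len by (cases P2) (auto simp: S_def P3)
    moreover have "(case c of Col b \<Rightarrow> Some b | _ \<Rightarrow> None) = (if r \<and> Ws = [] then T else None)"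
      using c_in labelling_length[OF 3] by (auto simp: T_def P3)
    ultimately show ?thesis
      by (simp add: idx_def P3)
  qed
  show "mat_cmp A B E f g l r Us Ws Vs \<phi> \<psi> (idx (P1 @ P2 @ P3), z1 @ z2 @ z3) =
      \<phi> (idx (P1 @ hd (P2 @ P3) # P3), z1 @ \<psi> (idx (P2 @ [hd P3]), z2) # z3)"
    using labelling_points_of_idx(2)[OF assms(1)]
    unfolding mat_cmp_def Let_def idx_outer idx_inner idx_comp
    by (auto simp: m1 m2 len Nil simp del: mids_append)
qed

section \<open>Typing of the operations\<close>

abbreviation M where "M \<equiv> mat_bsm A B E f g"

lemma mor_iff:
  "mor M l r xs y h \<longleftrightarrow>
     set xs \<subseteq> matrices A B \<and> y \<in> matrices A B \<and> nondegenerate l r xs \<and>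
     h \<in> extensional (dom_mor A B E f g l r xs) \<and>
     (\<forall>P zs. labelling l r xs P zs \<longrightarrow>
       h (idx P, zs) \<in> y (row_of f (hd P), col_of g (last P)))"
proof -
  have "mor M l r xs y h \<longleftrightarrow> set xs \<subseteq> matrices A B \<and> y \<in> matrices A B \<and> nondegenerate l r xs \<and>
      h \<in> mat_hom A B E f g l r xs y"
    by (simp add: mor_def mat_bsm_def nondegenerate_def)
  then show ?thesis using mat_hom_labelling by blast
qed

lemma extensional_mat [simp]:
  "mat_lloosen A B E f g r xs h \<in> extensional (dom_mor A B E f g False r xs)"
  "mat_rloosen A B E f g l xs h \<in> extensional (dom_mor A B E f g l False xs)"
  "mat_ident A B E f g x \<in> extensional (dom_mor A B E f g True True [x])"
  "mat_cmp A B E f g l r us ws vs k h \<in> extensional (dom_mor A B E f g l r (us @ vs @ ws))"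
  by (simp_all add: mat_lloosen_def mat_rloosen_def mat_ident_def mat_cmp_def)

lemma mat_bsm_simps [simp]:
  "Obj M = matrices A B"
  "lloosen M r xs y h = mat_lloosen A B E f g r xs h"
  "rloosen M l xs y h = mat_rloosen A B E f g l xs h"
  "ident M x = mat_ident A B E f g x"
  "cmp M l r us x ws vs y k h = mat_cmp A B E f g l r us ws vs k h"
  by (simp_all add: mat_bsm_def)

text \<open>The typing of \<open>h\<close> puts its value into the factor between the two cut
  points, so the outer arguments form a labelling again. Iterated composites can thus be unfolded
  one after another.\<close>

lemma labelling_inner_value:
  assumes "mor M (l \<and> us = []) (r \<and> ws = []) vs x h"
    and "labelling l r (us @ vs @ ws) (P1 @ P2 @ P3) (z1 @ z2 @ z3)"
    and len: "length P1 = length us" "length z1 = length us" "length P2 = length vs"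
      "length z2 = length vs"
  shows "labelling l r (us @ x # ws) (P1 @ hd (P2 @ P3) # P3)
      (z1 @ h (idx (P2 @ [hd P3]), z2) # z3)"
    and "mat_cmp A B E f g l r us ws vs k h (idx (P1 @ P2 @ P3), z1 @ z2 @ z3) =
      k (idx (P1 @ hd (P2 @ P3) # P3), z1 @ h (idx (P2 @ [hd P3]), z2) # z3)"
proof -
  have nd: "nondegenerate (l \<and> us = []) (r \<and> ws = []) vs"
    using assms(1) by (simp add: mor_iff)
  have "P3 \<noteq> []"
    using labelling_length[OF assms(2)] len by auto
  then have "hd (P2 @ [hd P3]) = hd (P2 @ P3)" by (cases P2) auto
  moreover have "h (idx (P2 @ [hd P3]), z2) \<in>
      x (row_of f (hd (P2 @ [hd P3])), col_of g (last (P2 @ [hd P3])))"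
    using assms(1) labelling_inner[OF assms(2) len nd] unfolding mor_iff by blast
  ultimately show "labelling l r (us @ x # ws) (P1 @ hd (P2 @ P3) # P3)
      (z1 @ h (idx (P2 @ [hd P3]), z2) # z3)"
    by (intro labelling_outer[OF assms(2) len nd]) simp
  show "mat_cmp A B E f g l r us ws vs k h (idx (P1 @ P2 @ P3), z1 @ z2 @ z3) =
      k (idx (P1 @ hd (P2 @ P3) # P3), z1 @ h (idx (P2 @ [hd P3]), z2) # z3)"
    by (rule mat_cmp_labelling[OF assms(2) len nd])
qed

lemma labelling_neq_Nil: "labelling l r xs P zs \<Longrightarrow> P \<noteq> []"
  using labelling_length by fastforce

lemma mor_lloosen:
  assumes "mor M True r xs y h"
  shows "mor M False r xs y (mat_lloosen A B E f g r xs h)"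
  unfolding mor_iff
proof (intro conjI allI impI)
  fix P zs assume L: "labelling False r xs P zs"
  then obtain p P' where P: "P = p # P'" using labelling_neq_Nil[OF L] by (cases P) auto
  have "xs \<noteq> []" using assms by (auto simp: mor_iff nondegenerate_def)
  with L have "P' \<noteq> []" unfolding P by (cases xs; cases zs) auto
  then show "mat_lloosen A B E f g r xs h (idx P, zs) \<in> y (row_of f (hd P), col_of g (last P))"
    using labelling_lloosen[OF L[unfolded P] \<open>xs \<noteq> []\<close>] assms by (fastforce simp: mor_iff P)
qed (use assms in \<open>auto simp: mor_iff nondegenerate_def\<close>)

lemma mor_rloosen:
  assumes "mor M l True xs y h"
  shows "mor M l False xs y (mat_rloosen A B E f g l xs h)"
  unfolding mor_iff
proof (intro conjI allI impI)
  fix P zs assume L: "labelling l False xs P zs"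
  then obtain q P' where P: "P = P' @ [q]" using labelling_neq_Nil[OF L] by (cases P rule: rev_cases) auto
  have "xs \<noteq> []" using assms by (auto simp: mor_iff nondegenerate_def)
  with labelling_length[OF L] have "P' \<noteq> []" unfolding P by auto
  then show "mat_rloosen A B E f g l xs h (idx P, zs) \<in> y (row_of f (hd P), col_of g (last P))"
    using labelling_rloosen[OF L[unfolded P] \<open>xs \<noteq> []\<close>] assms by (fastforce simp: mor_iff P)
qed (use assms in \<open>auto simp: mor_iff nondegenerate_def\<close>)

lemma labelling_single:
  "labelling l r [x] P zs \<longleftrightarrow> (\<exists>p q z. P = [p, q] \<and> zs = [z] \<and>
     p \<in> points l False \<and> q \<in> points False r \<and> z \<in> x (row_of f p, col_of g q))"
  by (auto simp: labelling_Cons)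

lemma mat_ident_labelling:
  "labelling True True [x] P zs \<Longrightarrow> mat_ident A B E f g x (idx P, zs) = hd zs"
  using labelling_points_of_idx(2)[of True True "[x]" P zs] by (auto simp: mat_ident_def)

lemma mor_ident: "x \<in> matrices A B \<Longrightarrow> mor M True True [x] x (mat_ident A B E f g x)"
  by (auto simp: mor_iff nondegenerate_def mat_ident_labelling) (auto simp: labelling_single)

lemma mor_loosened_ident:
  assumes "x \<in> matrices A B"
  shows "mor M l r [x] x (loosened_ident M l r x)"
  using mor_ident[OF assms] by (auto simp: loosened_ident_def Let_def mor_lloosen mor_rloosen)

text \<open>The identity returns its argument at every index, and loosening changes only the
  index.\<close>

lemma loosened_ident_labelling:
  assumes "labelling l r [x] P zs"
  shows "loosened_ident M l r x (idx P, zs) = hd zs"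
proof -
  \<comment> \<open>Right-loosening comes first, as in \<open>loosened_ident\<close>. The list
    \<open>P\<close> stays arbitrary because left-loosening then changes its first point.\<close>
  have r: "(if r then mat_ident A B E f g x else mat_rloosen A B E f g True [x] (mat_ident A B E f g x))
      (idx P, zs) = hd zs" if L: "labelling True r [x] P zs" for P
  proof (cases r)
    case False
    with L obtain p q z where P: "P = [p] @ [q]" by (auto simp: labelling_single)
    show ?thesis
      using labelling_rloosen[of True "[x]" "[p]" q zs] L False
      by (simp add: P mat_ident_labelling)
  qed (use L mat_ident_labelling in auto)
  show ?thesis
  proof (cases l)
    case False
    with assms obtain p q z where P: "P = p # [q]" by (auto simp: labelling_single)
    show ?thesis
      using labelling_lloosen[of r "[x]" p "[q]" zs] assms False r[of "[Row (row_of f p), q]"]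
      by (simp add: P loosened_ident_def Let_def split: if_splits)
  qed (use r[of P] assms in \<open>auto simp: loosened_ident_def Let_def\<close>)
qed

lemma mor_cmp:
  assumes k: "mor M l r (us @ x # ws) y k" and h: "mor M (l \<and> us = []) (r \<and> ws = []) vs x h"
  shows "mor M l r (us @ vs @ ws) y (mat_cmp A B E f g l r us ws vs k h)"
  unfolding mor_iff
proof (intro conjI allI impI)
  fix P zs assume L: "labelling l r (us @ vs @ ws) P zs"
  then obtain P1 P2 P3 z1 z2 z3 where P: "P = P1 @ P2 @ P3" "zs = z1 @ z2 @ z3"
    and len: "length P1 = length us" "length z1 = length us" "length P2 = length vs"
      "length z2 = length vs" "length P3 = Suc (length ws)"
    by (rule labelling_split)
  \<comment> \<open>The outer list has the same outermost points as the composite, hence the same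
    target set.\<close>
  then have "hd (P1 @ hd (P2 @ P3) # P3) = hd P" "last (P1 @ hd (P2 @ P3) # P3) = last P"
    by (cases P1; cases P3; auto)+
  with labelling_inner_value[OF h L[unfolded P] len(1-4)] k
  show "mat_cmp A B E f g l r us ws vs k h (idx P, zs) \<in> y (row_of f (hd P), col_of g (last P))"
    unfolding P mor_iff by metis
qed (use k h in \<open>auto simp: mor_iff nondegenerate_def\<close>)

section \<open>The equational axioms\<close>

lemma loosen_commute:
  assumes "mor M True True xs y h"
  shows "mat_lloosen A B E f g False xs (mat_rloosen A B E f g True xs h) =
    mat_rloosen A B E f g False xs (mat_lloosen A B E f g True xs h)"
proof (rule matmor_eqI[of _ False False xs])
  fix P zs assume L: "labelling False False xs P zs"
  have xs: "xs \<noteq> []" using assms by (auto simp: mor_iff nondegenerate_def)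
  \<comment> \<open>One factor means at least two points, so the two loosenings change different
    points.\<close>
  with labelling_length[OF L] have "2 \<le> length P" by (cases xs) auto
  then obtain p Q q where P: "P = p # Q @ [q]"
    by (cases P rule: rev_cases; cases "butlast P") auto
  note 1 = labelling_lloosen[OF L[unfolded P] xs]
  note 2 = labelling_rloosen[of False "xs" "p # Q" q zs]
  note 3 = labelling_rloosen[of True "xs" "Row (row_of f p) # Q" q zs]
  note 4 = labelling_lloosen[of True "xs" p "Q @ [Col (col_of g q)]" zs]
  show "mat_lloosen A B E f g False xs (mat_rloosen A B E f g True xs h) (idx P, zs) =
    mat_rloosen A B E f g False xs (mat_lloosen A B E f g True xs h) (idx P, zs)"
    using 1 2 3 4 L xs by (simp add: P)
qed auto

text \<open>Only the first point changes. If \<open>us\<close> is nonempty, it lies in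
  \<open>P1\<close> and the inner morphism is unaffected; if \<open>us\<close> is empty, the inner
  and the outer list both begin with it, so both morphisms are loosened.\<close>

lemma lloosen_cmp:
  assumes k: "mor M True r (us @ x # ws) y k" and h: "mor M (us = []) (r \<and> ws = []) vs x h"
  shows "mat_lloosen A B E f g r (us @ vs @ ws) (mat_cmp A B E f g True r us ws vs k h) =
    mat_cmp A B E f g False r us ws vs (mat_lloosen A B E f g r (us @ x # ws) k)
      (if us = [] then mat_lloosen A B E f g (r \<and> ws = []) vs h else h)" (is "?lhs = ?rhs")
proof (rule matmor_eqI[of _ False r "us @ vs @ ws"])
  fix P zs assume L: "labelling False r (us @ vs @ ws) P zs"
  then obtain P1 P2 P3 z1 z2 z3 where P: "P = P1 @ P2 @ P3" "zs = z1 @ z2 @ z3"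
    and len: "length P1 = length us" "length z1 = length us" "length P2 = length vs"
      "length z2 = length vs" "length P3 = Suc (length ws)"
    by (rule labelling_split)
  let ?h = "if us = [] then mat_lloosen A B E f g (r \<and> ws = []) vs h else h"
  have h': "mor M (False \<and> us = []) (r \<and> ws = []) vs x ?h"
    using h mor_lloosen by auto
  have hT: "mor M (True \<and> us = []) (r \<and> ws = []) vs x h"
    using h by simp
  have ne: "us @ vs @ ws \<noteq> []" "us = [] \<Longrightarrow> vs \<noteq> []"
    using h by (auto simp: mor_iff nondegenerate_def)
  note R = labelling_inner_value[OF h' L[unfolded P] len(1-4)]
  have nd: "nondegenerate (False \<and> us = []) (r \<and> ws = []) vs"
    using h' unfolding mor_iff by blast
  note I = labelling_inner[OF L[unfolded P] len(1-4) nd]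
  show "?lhs (idx P, zs) = ?rhs (idx P, zs)"
  proof (cases us)
    case Nil
    \<comment> \<open>A left-tight \<open>h\<close> has an input, so the changed point lies in
      \<open>P2\<close> and not in \<open>P3\<close>.\<close>
    with ne len obtain p P2' where P2: "P2 = p # P2'" by (cases P2) auto
    have L': "labelling False r (us @ vs @ ws) (p # P2' @ P3) (z2 @ z3)"
      using L Nil len by (simp add: P P2)
    note 1 = labelling_lloosen[OF L' ne(1)]
    have "labelling True r (us @ vs @ ws) ([] @ (Row (row_of f p) # P2') @ P3) ([] @ z2 @ z3)"
      using 1(1) by simp
    from labelling_inner_value(2)[OF hT this]
    have 2: "mat_cmp A B E f g True r us ws vs k h (idx (Row (row_of f p) # P2' @ P3), z2 @ z3) =
      k (idx (Row (row_of f p) # P3), h (idx (Row (row_of f p) # P2' @ [hd P3]), z2) # z3)"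
      using Nil len P2 by simp
    have "labelling False (r \<and> ws = []) vs (p # P2' @ [hd P3]) z2"
      using I P2 by simp
    note 3 = labelling_lloosen[OF this ne(2)[OF Nil]]
    have 4: "labelling False r (us @ x # ws) (p # P3) (?h (idx (P2 @ [hd P3]), z2) # z3)"
      using R(1) Nil len P2 by simp
    note 5 = labelling_lloosen[OF 4]
    show ?thesis
      using 1 2 3 5 R(2) Nil len by (simp add: P P2)
  next
    case (Cons u us')
    with len obtain p P1' where P1: "P1 = p # P1'" by (cases P1) auto
    have L': "labelling False r (us @ vs @ ws) (p # P1' @ P2 @ P3) (z1 @ z2 @ z3)"
      using L by (simp add: P P1)
    note 1 = labelling_lloosen[OF L' ne(1)]
    have "labelling True r (us @ vs @ ws) ((Row (row_of f p) # P1') @ P2 @ P3) (z1 @ z2 @ z3)"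
      using 1(1) by simp
    from labelling_inner_value(2)[OF hT this]
    have 2: "mat_cmp A B E f g True r us ws vs k h
        (idx (Row (row_of f p) # P1' @ P2 @ P3), z1 @ z2 @ z3) =
      k (idx (Row (row_of f p) # P1' @ hd (P2 @ P3) # P3), z1 @ h (idx (P2 @ [hd P3]), z2) # z3)"
      using len P1 by simp
    have 4: "labelling False r (us @ x # ws) (p # P1' @ hd (P2 @ P3) # P3)
        (z1 @ ?h (idx (P2 @ [hd P3]), z2) # z3)"
      using R(1) P1 by simp
    note 5 = labelling_lloosen[OF 4]
    show ?thesis
      using 1 2 5 R(2) Cons by (simp add: P P1)
  qed
qed auto

text \<open>Here the changed point is always the last one of \<open>P3\<close>. It also ends the
  inner list exactly if \<open>P3\<close> has no other point, i.e. if \<open>ws\<close> is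
  empty.\<close>

lemma rloosen_cmp:
  assumes k: "mor M l True (us @ x # ws) y k" and h: "mor M (l \<and> us = []) (ws = []) vs x h"
  shows "mat_rloosen A B E f g l (us @ vs @ ws) (mat_cmp A B E f g l True us ws vs k h) =
    mat_cmp A B E f g l False us ws vs (mat_rloosen A B E f g l (us @ x # ws) k)
      (if ws = [] then mat_rloosen A B E f g (l \<and> us = []) vs h else h)" (is "?lhs = ?rhs")
proof (rule matmor_eqI[of _ l False "us @ vs @ ws"])
  fix P zs assume L: "labelling l False (us @ vs @ ws) P zs"
  then obtain P1 P2 P3 z1 z2 z3 where P: "P = P1 @ P2 @ P3" "zs = z1 @ z2 @ z3"
    and len: "length P1 = length us" "length z1 = length us" "length P2 = length vs"
      "length z2 = length vs" "length P3 = Suc (length ws)" "length z3 = length ws"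
    by (rule labelling_split)
  let ?h = "if ws = [] then mat_rloosen A B E f g (l \<and> us = []) vs h else h"
  have h': "mor M (l \<and> us = []) (False \<and> ws = []) vs x ?h"
    using h mor_rloosen by auto
  have hT: "mor M (l \<and> us = []) (True \<and> ws = []) vs x h"
    using h by simp
  have ne: "us @ vs @ ws \<noteq> []" "ws = [] \<Longrightarrow> vs \<noteq> []"
    using h by (auto simp: mor_iff nondegenerate_def)
  note R = labelling_inner_value[OF h' L[unfolded P] len(1-4)]
  have nd: "nondegenerate (l \<and> us = []) (False \<and> ws = []) vs"
    using h' unfolding mor_iff by blast
  note I = labelling_inner[OF L[unfolded P] len(1-4) nd]
  obtain Q q where P3: "P3 = Q @ [q]" using len by (cases P3 rule: rev_cases) auto
  let ?q = "Col (col_of g q)"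
  have L': "labelling l False (us @ vs @ ws) ((P1 @ P2 @ Q) @ [q]) zs"
    using L by (simp add: P P3)
  note 1 = labelling_rloosen[OF L' ne(1)]
  have "labelling l True (us @ vs @ ws) (P1 @ P2 @ Q @ [?q]) (z1 @ z2 @ z3)"
    using 1(1) by (simp add: P)
  note 2 = labelling_inner_value(2)[OF hT this len(1-4)]
  have 4: "labelling l False (us @ x # ws) ((P1 @ hd (P2 @ P3) # Q) @ [q])
      (z1 @ ?h (idx (P2 @ [hd P3]), z2) # z3)"
    using R(1) by (simp add: P3)
  note 5 = labelling_rloosen[OF 4]
  show "?lhs (idx P, zs) = ?rhs (idx P, zs)"
  proof (cases "ws = []")
    case True
    with len P3 have [simp]: "Q = []" by simp
    \<comment> \<open>Hence the first cut point \<open>hd (P2 @ P3)\<close> is not the changed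
      one.\<close>
    have "P2 \<noteq> []" using ne True len by auto
    have "labelling (l \<and> us = []) False vs (P2 @ [q]) z2"
      using I P3 by simp
    note 3 = labelling_rloosen[OF this ne(2)[OF True]]
    show ?thesis
      using 1 2 3 5 R(2) True \<open>P2 \<noteq> []\<close> len by (simp add: P P3 hd_append)
  next
    case False
    \<comment> \<open>Hence neither cut point is the changed one, and the value of \<open>h\<close>
      stays the same.\<close>
    with len P3 have "Q \<noteq> []" by auto
    show ?thesis
      using 1 2 5 R(2) False \<open>Q \<noteq> []\<close> len by (simp add: P P3 hd_append)
  qed
qed auto

text \<open>With one inner factor, the outer list is the list of the composite, and the inserted
  value is the original argument.\<close>

lemma cmp_ident:
  assumes k: "mor M l r (us @ x # ws) y k"
  shows "mat_cmp A B E f g l r us ws [x] k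
    (loosened_ident M (l \<and> us = []) (r \<and> ws = []) x) = k" (is "?lhs = k")
proof (rule matmor_eqI[of _ l r "us @ [x] @ ws"])
  have x: "mor M (l \<and> us = []) (r \<and> ws = []) [x] x
      (loosened_ident M (l \<and> us = []) (r \<and> ws = []) x)" (is "mor M ?l ?r _ _ _")
    using k by (intro mor_loosened_ident) (auto simp: mor_iff)
  then have nd: "nondegenerate ?l ?r [x]" by (simp add: mor_iff)
  fix P zs assume L: "labelling l r (us @ [x] @ ws) P zs"
  then obtain P1 P2 P3 z1 z2 z3 where P: "P = P1 @ P2 @ P3" "zs = z1 @ z2 @ z3"
    and len: "length P1 = length us" "length z1 = length us" "length P2 = length [x]"
      "length z2 = length [x]" "length P3 = Suc (length ws)"
    by (rule labelling_split)
  obtain p z where p: "P2 = [p]" "z2 = [z]"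
    using len by (auto simp: length_Suc_conv)
  show "?lhs (idx P, zs) = k (idx P, zs)"
    using labelling_inner_value(2)[OF x L[unfolded P] len(1-4)]
      loosened_ident_labelling[OF labelling_inner[OF L[unfolded P] len(1-4) nd]]
    by (simp add: P p)
next
  show "?lhs \<in> extensional (dom_mor A B E f g l r (us @ [x] @ ws))"
    by (rule extensional_mat)
qed (use k in \<open>simp add: mor_iff\<close>)

text \<open>With no factors beside it, the inner morphism is taken at the whole list, and the
  identity returns its value.\<close>

lemma ident_cmp:
  assumes h: "mor M l r vs x h"
  shows "mat_cmp A B E f g l r [] [] vs (loosened_ident M l r x) h = h" (is "?lhs = h")
proof (rule matmor_eqI[of _ l r "[] @ vs @ []"])
  fix P zs assume L: "labelling l r ([] @ vs @ []) P zs"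
  then obtain P2 P3 z2 where P: "P = [] @ P2 @ P3" "zs = [] @ z2 @ []"
    and len: "length P2 = length vs" "length z2 = length vs" "length P3 = Suc (length [])"
    by (rule labelling_split) auto
  obtain q where q: "P3 = [q]"
    using len by (auto simp: length_Suc_conv)
  have "mor M (l \<and> [] = []) (r \<and> [] = []) vs x h" using h by simp
  note 1 = labelling_inner_value[OF this L[unfolded P]]
  show "?lhs (idx P, zs) = h (idx P, zs)"
    using 1 len loosened_ident_labelling[of l r x] by (simp add: P q)
next
  show "?lhs \<in> extensional (dom_mor A B E f g l r ([] @ vs @ []))"
    by (rule extensional_mat)
qed (use h in \<open>simp add: mor_iff\<close>)

lemma split3:
  assumes "length P = length us + length vs + length ws"
  obtains P1 P2 P3 where "P = P1 @ P2 @ P3" "length P1 = length us" "length P2 = length vs"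
    "length P3 = length ws"
  using that[of "take (length us) P" "take (length vs) (drop (length us) P)"
      "drop (length vs) (drop (length us) P)"] assms by (simp del: drop_drop)

text \<open>The points fall into five pieces, for \<open>us\<close>, \<open>vs\<close>,
  \<open>ts\<close>, \<open>ws\<close> and \<open>zs\<close>. Both bracketings cut at the same
  points: the value of \<open>j\<close> on the middle piece enters \<open>h\<close>, and the value
  of \<open>h\<close> enters \<open>k\<close>.\<close>

lemma cmp_assoc:
  assumes k: "mor M l r (us @ y # zs) z k"
    and h: "mor M (l \<and> us = []) (r \<and> zs = []) (vs @ x # ws) y h"
    and j: "mor M (l \<and> us = [] \<and> vs = []) (r \<and> zs = [] \<and> ws = []) ts x j"
  shows "mat_cmp A B E f g l r us zs (vs @ ts @ ws) k
      (mat_cmp A B E f g (l \<and> us = []) (r \<and> zs = []) vs ws ts h j) =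
    mat_cmp A B E f g l r (us @ vs) (ws @ zs) ts
      (mat_cmp A B E f g l r us zs (vs @ x # ws) k h) j" (is "?lhs = ?rhs")
proof (rule matmor_eqI[of _ l r "us @ (vs @ ts @ ws) @ zs"])
  fix P as assume L: "labelling l r (us @ (vs @ ts @ ws) @ zs) P as"
  then obtain P1 Q P5 a1 b a5 where P: "P = P1 @ Q @ P5" "as = a1 @ b @ a5"
    and len: "length P1 = length us" "length a1 = length us"
      "length Q = length (vs @ ts @ ws)" "length b = length (vs @ ts @ ws)"
      "length P5 = Suc (length zs)" "length a5 = length zs"
    by (rule labelling_split)
  obtain P2 P3 P4 where Q: "Q = P2 @ P3 @ P4" "length P2 = length vs" "length P3 = length ts"
      "length P4 = length ws"
    using len(3) by (auto intro: split3[of Q vs ts ws])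
  obtain a2 a3 a4 where b: "b = a2 @ a3 @ a4" "length a2 = length vs" "length a3 = length ts"
      "length a4 = length ws"
    using len(4) by (auto intro: split3[of b vs ts ws])
  obtain q P5' where P5: "P5 = q # P5'" using len by (cases P5) auto
  have j': "mor M ((l \<and> us = []) \<and> vs = []) ((r \<and> zs = []) \<and> ws = []) ts x j"
    using j by simp
  have j'': "mor M (l \<and> us @ vs = []) (r \<and> ws @ zs = []) ts x j"
    using j by (simp add: conj_ac)
  note hj = mor_cmp[OF h j']
  then have nd: "nondegenerate (l \<and> us = []) (r \<and> zs = []) (vs @ ts @ ws)"
    by (simp add: mor_iff)
  \<comment> \<open>Facts 1 and 2 unfold the two composites on the left side, facts 3 and 4 those on
    the right side.\<close>
  note 1 = labelling_inner_value[OF hj L[unfolded P] len(1-4)]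
  note I = labelling_inner[OF L[unfolded P] len(1-4) nd]
  have I': "labelling (l \<and> us = []) (r \<and> zs = []) (vs @ ts @ ws) (P2 @ P3 @ P4 @ [q])
      (a2 @ a3 @ a4)"
    using I by (simp add: Q b P5)
  note 2 = labelling_inner_value[OF j' I' Q(2) b(2) Q(3) b(3)]
  have L': "labelling l r ((us @ vs) @ ts @ ws @ zs) ((P1 @ P2) @ P3 @ P4 @ P5)
      ((a1 @ a2) @ a3 @ a4 @ a5)"
    using L by (simp add: P Q b)
  note 3 = labelling_inner_value[OF j'' L']
  have "labelling l r (us @ (vs @ x # ws) @ zs) (P1 @ (P2 @ hd (P3 @ P4 @ P5) # P4) @ P5)
      (a1 @ (a2 @ j (idx (P3 @ [hd (P4 @ P5)]), a3) # a4) @ a5)"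
    using 3(1) len Q b by simp
  note 4 = labelling_inner_value(2)[OF h this len(1,2)]
  show "?lhs (idx P, as) = ?rhs (idx P, as)"
    using 1(2) 2(2) 3(2) 4 len Q b by (simp add: P P5 hd_append)
next
  show "?rhs \<in> extensional (dom_mor A B E f g l r (us @ (vs @ ts @ ws) @ zs))"
    using extensional_mat(4)[of l r "us @ vs" "ws @ zs" ts] by (simp del: extensional_mat)
qed (rule extensional_mat)

text \<open>The pieces for \<open>ss\<close> and \<open>ts\<close> are separate, and replacing one
  of them by a single factor keeps the cut points of the other, even if \<open>vs\<close> is empty.
  So neither inner value depends on the order.\<close>

lemma cmp_interchange:
  assumes k: "mor M l r (us @ x # vs @ y # ws) z k"
    and h: "mor M (l \<and> us = []) False ss x h"
    and j: "mor M False (r \<and> ws = []) ts y j"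
  shows "mat_cmp A B E f g l r (us @ ss @ vs) ws ts
      (mat_cmp A B E f g l r us (vs @ y # ws) ss k h) j =
    mat_cmp A B E f g l r us (vs @ ts @ ws) ss
      (mat_cmp A B E f g l r (us @ x # vs) ws ts k j) h" (is "?lhs = ?rhs")
proof (rule matmor_eqI[of _ l r "us @ (ss @ vs @ ts) @ ws"])
  fix P as assume L: "labelling l r (us @ (ss @ vs @ ts) @ ws) P as"
  then obtain P1 Q P5 a1 b a5 where P: "P = P1 @ Q @ P5" "as = a1 @ b @ a5"
    and len: "length P1 = length us" "length a1 = length us"
      "length Q = length (ss @ vs @ ts)" "length b = length (ss @ vs @ ts)"
      "length P5 = Suc (length ws)" "length a5 = length ws"
    by (rule labelling_split)
  obtain P2 P3 P4 where Q: "Q = P2 @ P3 @ P4" "length P2 = length ss" "length P3 = length vs"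
      "length P4 = length ts"
    using len(3) by (auto intro: split3[of Q ss vs ts])
  obtain a2 a3 a4 where b: "b = a2 @ a3 @ a4" "length a2 = length ss" "length a3 = length vs"
      "length a4 = length ts"
    using len(4) by (auto intro: split3[of b ss vs ts])
  obtain q P5' where P5: "P5 = q # P5'" using len by (cases P5) auto
  have h1: "mor M (l \<and> us = []) (r \<and> vs @ y # ws = []) ss x h"
    using h by simp
  \<comment> \<open>On the right side, \<open>h\<close> is inserted to the left of
    \<open>vs @ ts @ ws\<close>. Were this empty and \<open>r\<close> true, \<open>h\<close> would
    have to be right-tight; but then \<open>j\<close> is right-tight and so \<open>ts\<close> is
    nonempty. The same holds for \<open>ss\<close> and \<open>j\<close> at the left end.\<close>
  have "ts \<noteq> []" if "r" "ws = []"
    using j that by (auto simp: mor_iff nondegenerate_def)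
  then have "(r \<and> vs @ ts @ ws = []) = False" by auto
  then have h2: "mor M (l \<and> us = []) (r \<and> vs @ ts @ ws = []) ss x h"
    using h by (simp only:)
  have j1: "mor M (l \<and> us @ x # vs = []) (r \<and> ws = []) ts y j"
    using j by simp
  have "ss \<noteq> []" if "l" "us = []"
    using h that by (auto simp: mor_iff nondegenerate_def)
  then have "(l \<and> us @ ss @ vs = []) = False" by auto
  then have j2: "mor M (l \<and> us @ ss @ vs = []) (r \<and> ws = []) ts y j"
    using j by (simp only:)
  have L1: "labelling l r ((us @ ss @ vs) @ ts @ ws) ((P1 @ P2 @ P3) @ P4 @ P5)
      ((a1 @ a2 @ a3) @ a4 @ a5)"
    and L2: "labelling l r (us @ ss @ vs @ ts @ ws) (P1 @ P2 @ P3 @ P4 @ P5)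
      (a1 @ a2 @ a3 @ a4 @ a5)"
    using L by (simp_all add: P Q b)
  note 1 = labelling_inner_value[OF j2 L1]
  have "labelling l r (us @ ss @ vs @ y # ws) (P1 @ P2 @ P3 @ hd (P4 @ P5) # P5)
      (a1 @ a2 @ a3 @ j (idx (P4 @ [hd P5]), a4) # a5)"
    using 1(1) len Q b by simp
  note 2 = labelling_inner_value(2)[OF h1 this len(1,2) Q(2) b(2)]
  note 3 = labelling_inner_value[OF h2 L2 len(1,2) Q(2) b(2)]
  have "labelling l r ((us @ x # vs) @ ts @ ws) ((P1 @ hd (P2 @ P3 @ P4 @ P5) # P3) @ P4 @ P5)
      ((a1 @ h (idx (P2 @ [hd (P3 @ P4 @ P5)]), a2) # a3) @ a4 @ a5)"
    using 3(1) by simp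
  note 4 = labelling_inner_value(2)[OF j1 this]
  show "?lhs (idx P, as) = ?rhs (idx P, as)"
    using 1(2) 2 3(2) 4 len Q b by (simp add: P P5 hd_append)
next
  show "?lhs \<in> extensional (dom_mor A B E f g l r (us @ (ss @ vs @ ts) @ ws))"
    using extensional_mat(4)[of l r "us @ ss @ vs" ws ts] by (simp del: extensional_mat)
  show "?rhs \<in> extensional (dom_mor A B E f g l r (us @ (ss @ vs @ ts) @ ws))"
    using extensional_mat(4)[of l r us "vs @ ts @ ws" ss] by (simp del: extensional_mat)
qed

theorem bi_skew_multicategory_mat_bsm: "bi_skew_multicategory M"
proof
qed (simp_all only: mat_bsm_simps mor_lloosen mor_rloosen mor_ident mor_cmp loosen_commute
    lloosen_cmp rloosen_cmp cmp_ident ident_cmp cmp_assoc cmp_interchange)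

section \<open>The monoid axioms at short lists of points\<close>

lemma matmor_eq_iff:
  assumes "\<phi> \<in> extensional (dom_mor A B E f g l r Xs)"
    and "\<psi> \<in> extensional (dom_mor A B E f g l r Xs)"
  shows "\<phi> = \<psi> \<longleftrightarrow> (\<forall>P zs. labelling l r Xs P zs \<longrightarrow> \<phi> (idx P, zs) = \<psi> (idx P, zs))"
  using matmor_eqI[OF assms] by blast

lemma labelling_mult:
  "labelling True True [C, C] P zs \<longleftrightarrow> (\<exists>a \<in> A. \<exists>i \<in> E. \<exists>b \<in> B. \<exists>h \<in> C (a, g i). \<exists>k \<in> C (f i, b).
     P = [Row a, Mid i, Col b] \<and> zs = [h, k])"
  by (fastforce simp: labelling_Cons)

lemma labelling_unit:
  "labelling False False [] P zs \<longleftrightarrow> (\<exists>i \<in> E. P = [Mid i] \<and> zs = [])"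
  by auto

lemma labelling_assoc:
  "labelling True True [C, C, C] P zs \<longleftrightarrow> (\<exists>a \<in> A. \<exists>i \<in> E. \<exists>j \<in> E. \<exists>b \<in> B.
     \<exists>h \<in> C (a, g i). \<exists>k \<in> C (f i, g j). \<exists>l \<in> C (f j, b).
     P = [Row a, Mid i, Mid j, Col b] \<and> zs = [h, k, l])"
  by (fastforce simp: labelling_Cons)

text \<open>At the points \<open>Mid i\<close>, \<open>Col b\<close> the nullary \<open>e\<close>
  doubles the first point, and loosening turns the first copy into \<open>Row (f i)\<close>. So
  \<open>m\<close> is taken at row \<open>f i\<close>, index \<open>i\<close> and column
  \<open>b\<close>.\<close>

lemma left_unit_iff:
  assumes m: "mor M True True [C, C] C m" and e: "mor M False False [] C e"
  shows "mat_cmp A B E f g False True [] [C] [] (mat_lloosen A B E f g True [C, C] m) e =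
      mat_lloosen A B E f g True [C] (mat_ident A B E f g C) \<longleftrightarrow>
    (\<forall>i\<in>E. \<forall>b\<in>B. \<forall>l\<in>C (f i, b).
       m ((Some (f i), [i], Some b), [e ((None, [i], None), []), l]) = l)"
    (is "?lhs = ?rhs \<longleftrightarrow> _")
proof -
  have eval: "?lhs (idx P, zs) = m ((Some (f i), [i], Some b), [e ((None, [i], None), []), l])"
    "?rhs (idx P, zs) = l"
    if P: "P = [Mid i, Col b]" "zs = [l]" and L: "labelling False True [C] P zs" for P zs i b l
  proof -
    have e': "mor M (False \<and> [] = []) (True \<and> [C] = []) [] C e" using e by simp
    \<comment> \<open>The first two pieces are empty because \<open>us\<close> and \<open>vs\<close>
      are; both points belong to the third.\<close>
    have "labelling False True ([] @ [] @ [C]) ([] @ [] @ [Mid i, Col b]) ([] @ [] @ [l])"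
      using L P by simp
    note 1 = labelling_inner_value[OF e' this]
    then have "labelling False True [C, C] (Mid i # [Mid i, Col b]) [e (idx [Mid i], []), l]"
      by simp
    note 2 = labelling_lloosen(2)[OF this]
    show "?lhs (idx P, zs) = m ((Some (f i), [i], Some b), [e ((None, [i], None), []), l])"
      using 1(2) 2 by (simp add: P idx_def)
    show "?rhs (idx P, zs) = l"
      using labelling_lloosen[OF L[unfolded P]] by (simp add: P mat_ident_labelling)
  qed
  have "?lhs = ?rhs \<longleftrightarrow>
    (\<forall>P zs. labelling False True [C] P zs \<longrightarrow> ?lhs (idx P, zs) = ?rhs (idx P, zs))"
    using extensional_mat(4)[of False True "[]" "[C]" "[]"] by (intro matmor_eq_iff) auto
  also have "\<dots> \<longleftrightarrow> (\<forall>i\<in>E. \<forall>b\<in>B. \<forall>l\<in>C (f i, b). ?lhs (idx [Mid i, Col b], [l]) = ?rhs (idx [Mid i, Col b], [l]))"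
    by (fastforce simp: labelling_single)
  also have "\<dots> \<longleftrightarrow> (\<forall>i\<in>E. \<forall>b\<in>B. \<forall>l\<in>C (f i, b).
       m ((Some (f i), [i], Some b), [e ((None, [i], None), []), l]) = l)"
    using eval[OF refl refl] by (intro ball_cong refl) (auto simp: labelling_single)
  finally show ?thesis .
qed

text \<open>Here \<open>e\<close> doubles the last point \<open>Mid i\<close>, and loosening turns
  the second copy into \<open>Col (g i)\<close>.\<close>

lemma right_unit_iff:
  assumes m: "mor M True True [C, C] C m" and e: "mor M False False [] C e"
  shows "mat_cmp A B E f g True False [C] [] [] (mat_rloosen A B E f g True [C, C] m) e =
      mat_rloosen A B E f g True [C] (mat_ident A B E f g C) \<longleftrightarrow>
    (\<forall>a\<in>A. \<forall>i\<in>E. \<forall>h\<in>C (a, g i).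
       m ((Some a, [i], Some (g i)), [h, e ((None, [i], None), [])]) = h)"
    (is "?lhs = ?rhs \<longleftrightarrow> _")
proof -
  have eval: "?lhs (idx P, zs) = m ((Some a, [i], Some (g i)), [h, e ((None, [i], None), [])])"
    "?rhs (idx P, zs) = h"
    if P: "P = [Row a] @ [Mid i]" "zs = [h]" and L: "labelling True False [C] P zs" for P zs a i h
  proof -
    have e': "mor M (True \<and> [C] = []) (False \<and> [] = []) [] C e" using e by simp
    have "labelling True False ([C] @ [] @ []) ([Row a] @ [] @ [Mid i]) ([h] @ [] @ [])"
      using L P by simp
    note 1 = labelling_inner_value[OF e' this]
    then have "labelling True False [C, C] ([Row a, Mid i] @ [Mid i]) [h, e (idx [Mid i], [])]"
      by simp
    note 2 = labelling_rloosen(2)[OF this]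
    show "?lhs (idx P, zs) = m ((Some a, [i], Some (g i)), [h, e ((None, [i], None), [])])"
      using 1(2) 2 by (simp add: P idx_def)
    show "?rhs (idx P, zs) = h"
      using labelling_rloosen[OF L[unfolded P]] by (simp add: P mat_ident_labelling)
  qed
  have "?lhs = ?rhs \<longleftrightarrow>
    (\<forall>P zs. labelling True False [C] P zs \<longrightarrow> ?lhs (idx P, zs) = ?rhs (idx P, zs))"
    using extensional_mat(4)[of True False "[C]" "[]" "[]"] by (intro matmor_eq_iff) auto
  also have "\<dots> \<longleftrightarrow> (\<forall>a\<in>A. \<forall>i\<in>E. \<forall>h\<in>C (a, g i).
      ?lhs (idx ([Row a] @ [Mid i]), [h]) = ?rhs (idx ([Row a] @ [Mid i]), [h]))"
    by (fastforce simp: labelling_single)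
  also have "\<dots> \<longleftrightarrow> (\<forall>a\<in>A. \<forall>i\<in>E. \<forall>h\<in>C (a, g i).
       m ((Some a, [i], Some (g i)), [h, e ((None, [i], None), [])]) = h)"
    using eval[OF refl refl] by (intro ball_cong refl) (auto simp: labelling_single)
  finally show ?thesis .
qed

text \<open>At the points \<open>Row a\<close>, \<open>Mid i\<close>, \<open>Mid j\<close>,
  \<open>Col b\<close>, the left side takes the inner \<open>m\<close> at the first three with
  \<open>Mid j\<close> loosened to \<open>Col (g j)\<close>; the right side takes it at the last
  three with \<open>Mid i\<close> loosened to \<open>Row (f i)\<close>.\<close>

lemma assoc_iff:
  assumes m: "mor M True True [C, C] C m"
  shows "mat_cmp A B E f g True True [] [C] [C, C] m (mat_rloosen A B E f g True [C, C] m) =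
      mat_cmp A B E f g True True [C] [] [C, C] m (mat_lloosen A B E f g True [C, C] m) \<longleftrightarrow>
    (\<forall>a\<in>A. \<forall>i\<in>E. \<forall>j\<in>E. \<forall>b\<in>B. \<forall>h\<in>C (a, g i). \<forall>k\<in>C (f i, g j). \<forall>l\<in>C (f j, b).
       m ((Some a, [j], Some b), [m ((Some a, [i], Some (g j)), [h, k]), l]) =
       m ((Some a, [i], Some b), [h, m ((Some (f i), [j], Some b), [k, l])]))"
    (is "?lhs = ?rhs \<longleftrightarrow> _")
proof -
  have eval: "?lhs (idx [Row a, Mid i, Mid j, Col b], [h, k, l]) =
      m ((Some a, [j], Some b), [m ((Some a, [i], Some (g j)), [h, k]), l])"
    "?rhs (idx [Row a, Mid i, Mid j, Col b], [h, k, l]) =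
      m ((Some a, [i], Some b), [h, m ((Some (f i), [j], Some b), [k, l])])"
    if ij: "a \<in> A" "i \<in> E" "j \<in> E" "b \<in> B" "h \<in> C (a, g i)" "k \<in> C (f i, g j)" "l \<in> C (f j, b)"
    for a i j b h k l
  proof -
    have m1: "mor M (True \<and> [] = []) (True \<and> [C] = []) [C, C] C (mat_rloosen A B E f g True [C, C] m)"
      using mor_rloosen[OF m] by simp
    have "labelling True True ([] @ [C, C] @ [C]) ([] @ [Row a, Mid i] @ [Mid j, Col b])
        ([] @ [h, k] @ [l])"
      using ij by simp
    note 1 = labelling_inner_value(2)[OF m1 this]
    have "labelling True False [C, C] ([Row a, Mid i] @ [Mid j]) [h, k]"
      using ij by simp
    note 2 = labelling_rloosen(2)[OF this]
    show "?lhs (idx [Row a, Mid i, Mid j, Col b], [h, k, l]) =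
        m ((Some a, [j], Some b), [m ((Some a, [i], Some (g j)), [h, k]), l])"
      using 1 2 by (simp add: idx_def)
    have m2: "mor M (True \<and> [C] = []) (True \<and> [] = []) [C, C] C (mat_lloosen A B E f g True [C, C] m)"
      using mor_lloosen[OF m] by simp
    have "labelling True True ([C] @ [C, C] @ []) ([Row a] @ [Mid i, Mid j] @ [Col b])
        ([h] @ [k, l] @ [])"
      using ij by simp
    note 3 = labelling_inner_value(2)[OF m2 this]
    have "labelling False True [C, C] (Mid i # [Mid j, Col b]) [k, l]"
      using ij by simp
    note 4 = labelling_lloosen(2)[OF this]
    show "?rhs (idx [Row a, Mid i, Mid j, Col b], [h, k, l]) =
        m ((Some a, [i], Some b), [h, m ((Some (f i), [j], Some b), [k, l])])"
      using 3 4 by (simp add: idx_def)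
  qed
  have "?lhs = ?rhs \<longleftrightarrow>
    (\<forall>P zs. labelling True True [C, C, C] P zs \<longrightarrow> ?lhs (idx P, zs) = ?rhs (idx P, zs))"
    using extensional_mat(4)[of True True "[C]" "[]" "[C, C]"]
      extensional_mat(4)[of True True "[]" "[C]" "[C, C]"] by (intro matmor_eq_iff) auto
  also have "\<dots> \<longleftrightarrow> (\<forall>a\<in>A. \<forall>i\<in>E. \<forall>j\<in>E. \<forall>b\<in>B. \<forall>h\<in>C (a, g i). \<forall>k\<in>C (f i, g j). \<forall>l\<in>C (f j, b).
      ?lhs (idx [Row a, Mid i, Mid j, Col b], [h, k, l]) =
      ?rhs (idx [Row a, Mid i, Mid j, Col b], [h, k, l]))"
    unfolding labelling_assoc by blast
  finally show ?thesis
    using eval by simp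
qed

lemma mor_mult_iff:
  "mor M True True [C, C] C m \<longleftrightarrow> C \<in> matrices A B \<and>
     m \<in> extensional (dom_mor A B E f g True True [C, C]) \<and>
     (\<forall>a\<in>A. \<forall>i\<in>E. \<forall>b\<in>B. \<forall>h\<in>C (a, g i). \<forall>k\<in>C (f i, b).
        m ((Some a, [i], Some b), [h, k]) \<in> C (a, b))"
proof -
  have "(\<forall>P zs. labelling True True [C, C] P zs \<longrightarrow>
       m (idx P, zs) \<in> C (row_of f (hd P), col_of g (last P))) \<longleftrightarrow>
    (\<forall>a\<in>A. \<forall>i\<in>E. \<forall>b\<in>B. \<forall>h\<in>C (a, g i). \<forall>k\<in>C (f i, b).
        m (idx [Row a, Mid i, Col b], [h, k]) \<in> C (a, b))"
    unfolding labelling_mult by force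
  then show ?thesis
    by (simp add: mor_iff nondegenerate_def idx_def)
qed

lemma mor_unit_iff:
  "mor M False False [] C e \<longleftrightarrow> C \<in> matrices A B \<and>
     e \<in> extensional (dom_mor A B E f g False False []) \<and>
     (\<forall>i\<in>E. e ((None, [i], None), []) \<in> C (f i, g i))"
proof -
  have "(\<forall>P zs. labelling False False [] P zs \<longrightarrow>
       e (idx P, zs) \<in> C (row_of f (hd P), col_of g (last P))) \<longleftrightarrow>
    (\<forall>i\<in>E. e (idx [Mid i], []) \<in> C (f i, g i))"
    unfolding labelling_unit by force
  then show ?thesis
    by (simp add: mor_iff nondegenerate_def idx_def)
qed

section \<open>Components and the bijection\<close>

lemma mult_components_apply [simp]:
  assumes "a \<in> A" "i \<in> E" "b \<in> B" "h \<in> C (a, g i)" "k \<in> C (f i, b)"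
  shows "mult_components A B E f g C m (a, i, b) (h, k) = m ((Some a, [i], Some b), [h, k])"
  using assms by (simp add: mult_components_def)

lemma unit_components_apply [simp]:
  "i \<in> E \<Longrightarrow> unit_components E e i = e ((None, [i], None), [])"
  by (simp add: unit_components_def)

lemma mult_components_PiE:
  "mult_components A B E f g C m \<in>
     (\<Pi>\<^sub>E (a, i, b) \<in> A \<times> E \<times> B. C (a, g i) \<times> C (f i, b) \<rightarrow>\<^sub>E C (a, b)) \<longleftrightarrow>
   (\<forall>a\<in>A. \<forall>i\<in>E. \<forall>b\<in>B. \<forall>h\<in>C (a, g i). \<forall>k\<in>C (f i, b).
      m ((Some a, [i], Some b), [h, k]) \<in> C (a, b))"
  unfolding PiE_iff by (auto simp: mult_components_def Pi_iff)

lemma unit_components_PiE: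
  "unit_components E e \<in> (\<Pi>\<^sub>E i \<in> E. C (f i, g i)) \<longleftrightarrow>
   (\<forall>i\<in>E. e ((None, [i], None), []) \<in> C (f i, g i))"
  unfolding PiE_iff by (auto simp: unit_components_def)

text \<open>The components record \<open>m\<close> and \<open>e\<close> only on their domains, so
  extensionality is stated separately. The laws correspond by the three equivalences above.\<close>

theorem bsm_monoid_iff_category:
  "bsm_monoid M C m e \<longleftrightarrow>
     m \<in> extensional (dom_mor A B E f g True True [C, C]) \<and>
     e \<in> extensional (dom_mor A B E f g False False []) \<and>
     category_on_span A B E f g C (mult_components A B E f g C m) (unit_components E e)"
proof (cases "mor M True True [C, C] C m \<and> mor M False False [] C e")
  case True
  then have m: "mor M True True [C, C] C m" and e: "mor M False False [] C e" by auto
  then have "m \<in> extensional (dom_mor A B E f g True True [C, C])"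
    "e \<in> extensional (dom_mor A B E f g False False [])" "C \<in> matrices A B"
    and mC: "\<And>a i b h k. \<lbrakk>a \<in> A; i \<in> E; b \<in> B; h \<in> C (a, g i); k \<in> C (f i, b)\<rbrakk> \<Longrightarrow>
        m ((Some a, [i], Some b), [h, k]) \<in> C (a, b)"
    and eC: "\<And>i. i \<in> E \<Longrightarrow> e ((None, [i], None), []) \<in> C (f i, g i)"
    by (auto simp: mor_mult_iff mor_unit_iff)
  \<comment> \<open>The category laws use composition also at row \<open>f i\<close> and at column
    \<open>g i\<close>; these lie in \<open>A\<close> and \<open>B\<close>, so the components there
    are values of \<open>m\<close>.\<close>
  moreover have "\<And>i. i \<in> E \<Longrightarrow> f i \<in> A" "\<And>i. i \<in> E \<Longrightarrow> g i \<in> B"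
    using f_in g_in by auto
  ultimately show ?thesis
    using m e
    by (simp add: bsm_monoid_def category_on_span_def left_unit_iff right_unit_iff assoc_iff
        mult_components_PiE unit_components_PiE cong: ball_cong)
next
  case False
  \<comment> \<open>Both sides fail: given extensionality and \<open>C \<in> matrices A B\<close>,
    the typing of \<open>m\<close> and \<open>e\<close> is equivalent to that of their
    components.\<close>
  then show ?thesis
    by (auto simp: bsm_monoid_def category_on_span_def mor_mult_iff mor_unit_iff
        mult_components_PiE unit_components_PiE)
qed

lemma ex_mult_components:
  assumes "c \<in> (\<Pi>\<^sub>E (a, i, b) \<in> A \<times> E \<times> B. C (a, g i) \<times> C (f i, b) \<rightarrow>\<^sub>E C (a, b))"
  obtains m where "m \<in> extensional (dom_mor A B E f g True True [C, C])"
    "mult_components A B E f g C m = c"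
proof
  \<comment> \<open>On this domain every index is of the form \<open>(Some a, [i], Some b)\<close>,
    so \<open>the\<close> and \<open>hd\<close> recover \<open>a\<close>, \<open>i\<close> and
    \<open>b\<close>.\<close>
  define m where "m = restrict (\<lambda>((s, js, t), zs). c (the s, hd js, the t) (zs ! 0, zs ! 1))
    (dom_mor A B E f g True True [C, C])"
  show "m \<in> extensional (dom_mor A B E f g True True [C, C])"
    by (simp add: m_def)
  have m: "m ((Some a, [i], Some b), [h, k]) = c (a, i, b) (h, k)"
    if "a \<in> A" "i \<in> E" "b \<in> B" "h \<in> C (a, g i)" "k \<in> C (f i, b)" for a i b h k
  proof -
    have "((Some a, [i], Some b), [h, k]) \<in> dom_mor A B E f g True True [C, C]"
      using labelling_points_of_idx(2)[of True True "[C, C]" "[Row a, Mid i, Col b]" "[h, k]"] that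
      by (simp add: idx_def)
    then show ?thesis by (simp add: m_def)
  qed
  show "mult_components A B E f g C m = c"
  proof (rule extensionalityI[of _ "A \<times> E \<times> B"])
    show "c \<in> extensional (A \<times> E \<times> B)"
      using assms by (simp add: PiE_iff)
    fix x assume "x \<in> A \<times> E \<times> B"
    then obtain a i b where x: "x = (a, i, b)" "a \<in> A" "i \<in> E" "b \<in> B" by blast
    then have "c x \<in> C (a, g i) \<times> C (f i, b) \<rightarrow>\<^sub>E C (a, b)"
      using assms by (auto dest: PiE_mem)
    then show "mult_components A B E f g C m x = c x"
      \<comment> \<open>Extensionality is applied a second time, now to the single component as a
        function on pairs.\<close>
      using x by (intro extensionalityI[of _ "C (a, g i) \<times> C (f i, b)"])
        (auto simp: m mult_components_def PiE_iff)
  qed (simp add: mult_components_def)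
qed

lemma ex_unit_components:
  assumes "u \<in> (\<Pi>\<^sub>E i \<in> E. C (f i, g i))"
  obtains e where "e \<in> extensional (dom_mor A B E f g False False ([] :: ('a \<times> 'b \<Rightarrow> 'x set) list))"
    "unit_components E e = u"
proof
  define e where "e = restrict (\<lambda>((s :: 'a option, js, t :: 'b option), zs :: 'x list). u (hd js))
    (dom_mor A B E f g False False ([] :: ('a \<times> 'b \<Rightarrow> 'x set) list))"
  show "e \<in> extensional (dom_mor A B E f g False False ([] :: ('a \<times> 'b \<Rightarrow> 'x set) list))"
    by (simp add: e_def)
  have e: "e ((None, [i], None), []) = u i" if "i \<in> E" for i
    using labelling_points_of_idx(2)[of False False "[] :: ('a \<times> 'b \<Rightarrow> 'x set) list" "[Mid i]" "[]"] that
    by (simp add: e_def idx_def)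
  show "unit_components E e = u"
    using assms by (intro extensionalityI[of _ E]) (auto simp: e unit_components_def PiE_iff)
qed

text \<open>The map is injective since every labelling of \<open>[C, C]\<close> or \<open>[]\<close>
  is one at which a component is read off. It is surjective since any category gives extensional
  \<open>m\<close> and \<open>e\<close> with its data as components, and the equivalence above makes
  them a monoid.\<close>

theorem bij_betw_monoids_categories:
  "bij_betw (\<lambda>(C, m, e). (C, mult_components A B E f g C m, unit_components E e))
    {(C :: 'a \<times> 'b \<Rightarrow> 'x set, m, e). bsm_monoid M C m e}
    {(C, c, u). category_on_span A B E f g C c u}"
proof (intro bij_betw_imageI inj_onI)
  have inj: "m = m' \<and> e = e'"
    if "bsm_monoid M C m e" "bsm_monoid M C m' e'"
      and eq: "mult_components A B E f g C m = mult_components A B E f g C m'"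
        "unit_components E e = unit_components E e'"
    for C :: "'a \<times> 'b \<Rightarrow> 'x set" and m m' and e e' :: "('a, 'b, 'e, 'x) matmor"
  proof
    show "m = m'"
    proof (rule matmor_eqI[of _ True True "[C, C]"])
      fix P zs assume "labelling True True [C, C] P zs"
      then show "m (idx P, zs) = m' (idx P, zs)"
        using mult_components_apply[of _ _ _ _ C _ m] mult_components_apply[of _ _ _ _ C _ m']
        unfolding labelling_mult eq(1) by (auto simp: idx_def)
    qed (use that in \<open>auto simp: bsm_monoid_iff_category\<close>)
    show "e = e'"
    proof (rule matmor_eqI[of _ False False "[] :: ('a \<times> 'b \<Rightarrow> 'x set) list"])
      fix P zs assume "labelling False False ([] :: ('a \<times> 'b \<Rightarrow> 'x set) list) P zs"
      then show "e (idx P, zs) = e' (idx P, zs)"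
        using unit_components_apply[of _ e] unit_components_apply[of _ e']
        unfolding labelling_unit eq(2) by (auto simp: idx_def)
    qed (use that in \<open>auto simp: bsm_monoid_iff_category\<close>)
  qed
  fix x y :: "('a \<times> 'b \<Rightarrow> 'x set) \<times> ('a, 'b, 'e, 'x) matmor \<times> ('a, 'b, 'e, 'x) matmor"
  assume "x \<in> {(C, m, e). bsm_monoid M C m e}" "y \<in> {(C, m, e). bsm_monoid M C m e}"
    "(case x of (C, m, e) \<Rightarrow> (C, mult_components A B E f g C m, unit_components E e)) =
     (case y of (C, m, e) \<Rightarrow> (C, mult_components A B E f g C m, unit_components E e))"
  then obtain C m e m' e' where xy: "x = (C, m, e)" "y = (C, m', e')"
    and *: "bsm_monoid M C m e" "bsm_monoid M C m' e'"
      "mult_components A B E f g C m = mult_components A B E f g C m'"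
      "unit_components E e = unit_components E e'"
    by auto
  show "x = y" using inj[OF *] xy by simp
next
  show "(\<lambda>(C, m, e). (C, mult_components A B E f g C m, unit_components E e)) `
      {(C :: 'a \<times> 'b \<Rightarrow> 'x set, m, e). bsm_monoid M C m e} =
      {(C, c, u). category_on_span A B E f g C c u}"
    (is "?F ` ?S = ?T")
  proof
    show "?F ` ?S \<subseteq> ?T"
      by (auto simp: bsm_monoid_iff_category)
    show "?T \<subseteq> ?F ` ?S"
    proof
      fix x assume "x \<in> ?T"
      then obtain C c u where x: "x = (C, c, u)" and cat: "category_on_span A B E f g C c u" by auto
      from cat obtain m where m: "m \<in> extensional (dom_mor A B E f g True True [C, C])"
        "mult_components A B E f g C m = c"
        unfolding category_on_span_def by (elim conjE ex_mult_components)
      from cat obtain e where e: "e \<in> extensional (dom_mor A B E f g False False ([] :: ('a \<times> 'b \<Rightarrow> 'x set) list))"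
        "unit_components E e = u"
        unfolding category_on_span_def by (elim conjE ex_unit_components)
      have "(C, m, e) \<in> ?S"
        using cat m e by (simp add: bsm_monoid_iff_category)
      then have "?F (C, m, e) \<in> ?F ` ?S" by (rule imageI)
      then show "x \<in> ?F ` ?S" by (simp add: x m e)
    qed
  qed
qed

end

theorem theorem3:
  fixes A :: "'a set" and B :: "'b set" and E :: "'e set"
    and f :: "'e \<Rightarrow> 'a" and g :: "'e \<Rightarrow> 'b"
    and M :: "('a \<times> 'b \<Rightarrow> 'x set, ('a, 'b, 'e, 'x) matmor) bsm"
  assumes "f \<in> E \<rightarrow> A" and "g \<in> E \<rightarrow> B"
  defines "M \<equiv> mat_bsm A B E f g"
  shows "bi_skew_multicategory M \<and>
    bij_betw (\<lambda>(C, m, e). (C, mult_components A B E f g C m, unit_components E e))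
      {(C, m, e). bsm_monoid M C m e}
      {(C, c, u). category_on_span A B E f g C c u}"
proof -
  interpret span A B E f g
    using assms(1,2) by unfold_locales
  show ?thesis
    unfolding M_def using bi_skew_multicategory_mat_bsm bij_betw_monoids_categories by blast
qed

end
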